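(* Let $\Sigma$ be a Y-network and let $\mathcal Z$ be a maximum cardinality set of state nodes that can be covered by vertex-disjoint stems in $\mathrm G(\Sigma)$. Let $\hat n_M=\max_i\hat n_i\ge 2$ be the maximum order of the subsystems in the extended system. Then the minimum number $\hat S_{\min}$ of subsystems of $\Sigma$ to be turned into higher-order heterogeneous ones in order to obtain a structurally output controllable extended system satisfies $$\frac{n-|\mathcal Z|}{\hat n_M}\ \le\ \hat S_{\min}\ \le\ n-|\mathcal Z|.$$
   Context: **Original network.** $\Sigma$ is the structured system $\dot x=Ax+Bu$, $y=x$ (so the output matrix is $C=I_n$), with $x\in\mathbb{R}^n$, $u\in\mathbb{R}^m$. Each entry of $A\in\mathbb{R}^{n\times n}$ and $B\in\mathbb{R}^{n\times m}$ is either fixed to zero or a free (independent, arbitrary real) parameter, and all diagonal entries of $A$ are fixed to zero. The $i$-th component $x_i$ is the state of the $i$-th (first-order) subsystem; $a_{ij}$ ($i\neq j$) are the off-diagonal entries of $A$ and $b_{i,s}$ the entries of $B$. For entries of a structured matrix, "$\neq 0$" means "is a free parameter". **Extended system.** An extended system of $\Sigma$ is a structured system $\hat\Sigma$: $\dot{\hat x}=\hat A\hat x+\hat Bu$, $\hat y=\hat C\hat x$, with orders $\hat n_i\ge 1$ ($i=1,\dots,n$), $\hat n=\sum_i\hat n_i$, $\hat x=(\hat x_1,\dots,\hat x_n)$, $\hat x_i\in\mathbb{R}^{\hat n_i}$. The diagonal blocks of $\hat A$ are $\hat a_i\in\mathbb{R}^{\hat n_i\times\hat n_i}$ and the off-diagonal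 blocks are $\hat a_{ij}\in\mathbb{R}^{\hat n_i\times\hat n_j}$; $\hat B$ has block rows $\hat b_i\in\mathbb{R}^{\hat n_i\times m}$ with columns $\hat b_{i,s}$; $\hat C=\mathrm{diag}(\hat c_1,\dots,\hat c_n)\in\mathbb{R}^{n\times\hat n}$ with $\hat c_i\in\mathbb{R}^{1\times\hat n_i}$. Each entry of these matrices is free or fixed subject to the following. The entries of $\hat a_{ij}$ ($i\ne j$) may be free only if $a_{ij}\neq 0$, and are otherwise zero. The entries of $\hat b_{i,s}$ may be free only if $b_{i,s}\neq0$, and are otherwise zero. For each $i$, the entries of $\hat a_i$ are either all free (heterogeneous internal dynamics) or all fixed to zero (trivial internal dynamics). All entries of $\hat c_i$ are free if $\hat n_i>1$, and $\hat c_i=1$ if $\hat n_i=1$. **Modifications considered and $\hat S_{\min}$.** A subsystem is turned into a higher-order heterogeneous one if $\hat n_i\ge2$ and all entries of $\hat a_i$ are free; it is unmodified if $\hat n_i=1$ and $\hat a_i=0$. For a given integer $\hat n_M\ge2$, $\hat S_{\min}$ is the smallest $\hat S$ for which there is a structurally output controllable extended system of $\Sigma$ with $\max_i\hat n_i=\hat n_M$ in which $\hat S$ subsystems are higher-order heterogeneous and all the others are unmodified. **Structural output controllability.** A structured system with state dimension $N$ and matrices $(A,B,C)$ is structurally output controllable if for some choice of the free parameters (including those of $C$) the matrix $C[B\ AB\ \cdots\ A^{N-1}B]$ has full row rank. **Graph.** $\mathrm G(\Sigma)$ is the directed graph whose nodes are the state nodes $x_1,\dots,x_n$ and the input nodes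 $u_1,\dots,u_m$, with an edge $(x_i,x_j)$ iff $A_{ji}\ne0$ and an edge $(u_i,x_j)$ iff $B_{ji}\neq0$. A stem is a sequence of distinct nodes $v_1,\dots,v_\ell$ with $(v_k,v_{k+1})$ an edge for all $k$, $v_1$ an input node and $v_\ell$ a state node. A cycle is a closed sequence $v_1,\dots,v_\ell=v_1$ with $(v_k,v_{k+1})$ an edge for all $k$ and $v_1,\dots,v_{\ell-1}$ distinct. A set of stems and cycles covers a set of nodes if each of these nodes lies on some member; vertex-disjoint means that no two members share a node (input nodes included). $\Sigma$ is input-accessible if every state node is the end vertex of a stem. **Conditions on a set $\mathcal P$ of stems and cycles.** $\mathcal P$ contains: 1) a stem and a cycle sharing some node; 2) two (distinct) cycles sharing some node; 3) two stems sharing some node and originating from different input nodes; 4) two (distinct) stems originating from the same input node. **Y-network.** An input-accessible network $\Sigma$ is a Y-network if every set of stems and cycles covering the state nodes of $\mathrm G(\Sigma)$ satisfies condition 4), but never satisfies any of conditions 1), 2), 3). *)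

theory Defs
  imports Complex_Main "Jordan_Normal_Form.DL_Rank"
begin

datatype entry = Fixed real | Free

definition realization :: "entry mat \<Rightarrow> real mat \<Rightarrow> bool" where
  "realization M R \<longleftrightarrow> R \<in> carrier_mat (dim_row M) (dim_col M) \<and>
     (\<forall>i<dim_row M. \<forall>j<dim_col M. \<forall>c. M $$ (i, j) = Fixed c \<longrightarrow> R $$ (i, j) = c)"

text \<open>The block matrix with \<open>dim_row A\<close> blocks \<open>B, A B, A\<^sup>2 B, \<dots>\<close>; its column \<open>j\<close> is column
  \<open>j mod m\<close> of \<open>A\<^bsup>j div m\<^esup> B\<close>, where \<open>m\<close> is the number of columns of \<open>B\<close>.\<close>

definition ctrb_mat :: "real mat \<Rightarrow> real mat \<Rightarrow> real mat" where
  "ctrb_mat A B = mat (dim_row A) (dim_row A * dim_col B)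
     (\<lambda>(i, j). (A ^\<^sub>m (j div dim_col B) * B) $$ (i, j mod dim_col B))"

definition output_controllable :: "real mat \<Rightarrow> real mat \<Rightarrow> real mat \<Rightarrow> bool" where
  "output_controllable A B C \<longleftrightarrow> vec_space.rank (dim_row C) (C * ctrb_mat A B) = dim_row C"

definition structurally_output_controllable :: "entry mat \<Rightarrow> entry mat \<Rightarrow> entry mat \<Rightarrow> bool" where
  "structurally_output_controllable A B C \<longleftrightarrow>
     (\<exists>A' B' C'. realization A A' \<and> realization B B' \<and> realization C C' \<and>
        output_controllable A' B' C')"

definition network :: "nat \<Rightarrow> nat \<Rightarrow> entry mat \<Rightarrow> entry mat \<Rightarrow> bool" where
  "network n m A B \<longleftrightarrow> A \<in> carrier_mat n n \<and> B \<in> carrier_mat n m \<and>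
     (\<forall>i<n. \<forall>j<n. A $$ (i, j) \<in> {Fixed 0, Free}) \<and>
     (\<forall>i<n. A $$ (i, i) = Fixed 0) \<and>
     (\<forall>i<n. \<forall>s<m. B $$ (i, s) \<in> {Fixed 0, Free})"

datatype node = State nat | Input nat

definition state_nodes :: "entry mat \<Rightarrow> node set" where
  "state_nodes A = State ` {..<dim_row A}"

definition input_nodes :: "entry mat \<Rightarrow> node set" where
  "input_nodes B = Input ` {..<dim_col B}"

fun edge :: "entry mat \<Rightarrow> entry mat \<Rightarrow> node \<Rightarrow> node \<Rightarrow> bool" where
  "edge A B (State i) (State j) \<longleftrightarrow> i < dim_row A \<and> j < dim_row A \<and> A $$ (j, i) = Free"
| "edge A B (Input s) (State j) \<longleftrightarrow> s < dim_col B \<and> j < dim_row A \<and> B $$ (j, s) = Free"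
| "edge A B _ (Input _) \<longleftrightarrow> False"

definition stem :: "entry mat \<Rightarrow> entry mat \<Rightarrow> node list \<Rightarrow> bool" where
  "stem A B p \<longleftrightarrow> p \<noteq> [] \<and> distinct p \<and> successively (edge A B) p \<and>
     hd p \<in> input_nodes B \<and> last p \<in> state_nodes A"

text \<open>A cycle has at least one edge; its first node is repeated at the end of the list.\<close>

definition cycle :: "entry mat \<Rightarrow> entry mat \<Rightarrow> node list \<Rightarrow> bool" where
  "cycle A B c \<longleftrightarrow> length c \<ge> 2 \<and> successively (edge A B) c \<and> hd c = last c \<and> distinct (butlast c)"

definition covers :: "node list set \<Rightarrow> node set \<Rightarrow> bool" where
  "covers P X \<longleftrightarrow> X \<subseteq> (\<Union>p\<in>P. set p)"

definition vertex_disjoint :: "node list set \<Rightarrow> bool" where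
  "vertex_disjoint P \<longleftrightarrow> pairwise (\<lambda>p q. set p \<inter> set q = {}) P"

definition input_accessible :: "entry mat \<Rightarrow> entry mat \<Rightarrow> bool" where
  "input_accessible A B \<longleftrightarrow> (\<forall>x\<in>state_nodes A. \<exists>p. stem A B p \<and> last p = x)"

definition stem_meets_cycle :: "entry mat \<Rightarrow> entry mat \<Rightarrow> node list set \<Rightarrow> bool" where
  "stem_meets_cycle A B P \<longleftrightarrow>
     (\<exists>p\<in>P. \<exists>c\<in>P. stem A B p \<and> cycle A B c \<and> set p \<inter> set c \<noteq> {})"

text \<open>Lists that are rotations of each other describe the same cycle, so cycles are compared
  through their edge sets.\<close>

definition cycle_meets_cycle :: "entry mat \<Rightarrow> entry mat \<Rightarrow> node list set \<Rightarrow> bool" where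
  "cycle_meets_cycle A B P \<longleftrightarrow>
     (\<exists>c\<in>P. \<exists>d\<in>P. cycle A B c \<and> cycle A B d \<and>
        set (zip c (tl c)) \<noteq> set (zip d (tl d)) \<and> set c \<inter> set d \<noteq> {})"

definition stems_of_different_inputs_meet ::
    "entry mat \<Rightarrow> entry mat \<Rightarrow> node list set \<Rightarrow> bool" where
  "stems_of_different_inputs_meet A B P \<longleftrightarrow>
     (\<exists>p\<in>P. \<exists>q\<in>P. stem A B p \<and> stem A B q \<and> hd p \<noteq> hd q \<and> set p \<inter> set q \<noteq> {})"

definition distinct_stems_of_same_input ::
    "entry mat \<Rightarrow> entry mat \<Rightarrow> node list set \<Rightarrow> bool" where
  "distinct_stems_of_same_input A B P \<longleftrightarrow>
     (\<exists>p\<in>P. \<exists>q\<in>P. stem A B p \<and> stem A B q \<and> p \<noteq> q \<and> hd p = hd q)"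

definition Y_network :: "entry mat \<Rightarrow> entry mat \<Rightarrow> bool" where
  "Y_network A B \<longleftrightarrow> input_accessible A B \<and>
     (\<forall>P. (\<forall>p\<in>P. stem A B p \<or> cycle A B p) \<and> covers P (state_nodes A) \<longrightarrow>
        distinct_stems_of_same_input A B P \<and>
        \<not> stem_meets_cycle A B P \<and>
        \<not> cycle_meets_cycle A B P \<and>
        \<not> stems_of_different_inputs_meet A B P)"

definition stem_coverable :: "entry mat \<Rightarrow> entry mat \<Rightarrow> node set \<Rightarrow> bool" where
  "stem_coverable A B Z \<longleftrightarrow> Z \<subseteq> state_nodes A \<and>
     (\<exists>P. (\<forall>p\<in>P. stem A B p) \<and> vertex_disjoint P \<and> covers P Z)"

definition max_stem_coverable :: "entry mat \<Rightarrow> entry mat \<Rightarrow> node set \<Rightarrow> bool" where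
  "max_stem_coverable A B Z \<longleftrightarrow> stem_coverable A B Z \<and>
     (\<forall>Z'. stem_coverable A B Z' \<longrightarrow> card Z' \<le> card Z)"

text \<open>The orders of the subsystems are \<open>k 0, \<dots>, k (n - 1)\<close>. The block of subsystem \<open>i\<close> starts
  at index \<open>offset k i\<close>, and the extended state dimension is \<open>offset k n\<close>.\<close>

definition offset :: "(nat \<Rightarrow> nat) \<Rightarrow> nat \<Rightarrow> nat" where
  "offset k i = (\<Sum>j<i. k j)"

definition all_block_entries :: "(nat \<Rightarrow> nat) \<Rightarrow> entry mat \<Rightarrow> nat \<Rightarrow> entry \<Rightarrow> bool" where
  "all_block_entries k Ah i e \<longleftrightarrow>
     (\<forall>p<k i. \<forall>q<k i. Ah $$ (offset k i + p, offset k i + q) = e)"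

definition extended_system ::
    "entry mat \<Rightarrow> entry mat \<Rightarrow> (nat \<Rightarrow> nat) \<Rightarrow> entry mat \<Rightarrow> entry mat \<Rightarrow> entry mat \<Rightarrow> bool" where
  "extended_system A B k Ah Bh Ch \<longleftrightarrow>
     (let n = dim_row A; m = dim_col B; N = offset k n in
        (\<forall>i<n. k i \<ge> 1) \<and>
        Ah \<in> carrier_mat N N \<and> Bh \<in> carrier_mat N m \<and> Ch \<in> carrier_mat n N \<and>
        (\<forall>i<n. \<forall>j<n. i \<noteq> j \<longrightarrow> (\<forall>p<k i. \<forall>q<k j.
           Ah $$ (offset k i + p, offset k j + q) = Fixed 0 \<or>
           Ah $$ (offset k i + p, offset k j + q) = Free \<and> A $$ (i, j) = Free)) \<and>
        (\<forall>i<n. \<forall>s<m. \<forall>p<k i.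
           Bh $$ (offset k i + p, s) = Fixed 0 \<or>
           Bh $$ (offset k i + p, s) = Free \<and> B $$ (i, s) = Free) \<and>
        (\<forall>i<n. all_block_entries k Ah i Free \<or> all_block_entries k Ah i (Fixed 0)) \<and>
        (\<forall>i<n. \<forall>j<n. \<forall>q<k j.
           Ch $$ (i, offset k j + q) =
             (if i \<noteq> j then Fixed 0 else if k j = 1 then Fixed 1 else Free)))"

definition higher_order_heterogeneous :: "(nat \<Rightarrow> nat) \<Rightarrow> entry mat \<Rightarrow> nat \<Rightarrow> bool" where
  "higher_order_heterogeneous k Ah i \<longleftrightarrow> k i \<ge> 2 \<and> all_block_entries k Ah i Free"

definition unmodified :: "(nat \<Rightarrow> nat) \<Rightarrow> entry mat \<Rightarrow> nat \<Rightarrow> bool" where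
  "unmodified k Ah i \<longleftrightarrow> k i = 1 \<and> all_block_entries k Ah i (Fixed 0)"

definition achievable :: "entry mat \<Rightarrow> entry mat \<Rightarrow> nat \<Rightarrow> nat \<Rightarrow> bool" where
  "achievable A B n_M S \<longleftrightarrow>
     (\<exists>k Ah Bh Ch. extended_system A B k Ah Bh Ch \<and>
        structurally_output_controllable Ah Bh Ch \<and>
        Max (k ` {..<dim_row A}) = n_M \<and>
        card {i. i < dim_row A \<and> higher_order_heterogeneous k Ah i} = S \<and>
        (\<forall>i<dim_row A. higher_order_heterogeneous k Ah i \<or> unmodified k Ah i))"

text \<open>Only meaningful if some \<open>S\<close> is achievable.\<close>

definition S_min :: "entry mat \<Rightarrow> entry mat \<Rightarrow> nat \<Rightarrow> nat" where
  "S_min A B n_M = (LEAST S. achievable A B n_M S)"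

end

theory Submission
  imports Defs "Jordan_Normal_Form.Char_Poly"
begin

text \<open>In a Y-network no stem meets a cycle and stems of different inputs are disjoint, so the graph is
  acyclic and every state \<open>i\<close> is reachable from exactly one input \<open>comp i\<close>. If \<open>lev i\<close> is the
  number of states on a longest stem ending in \<open>i\<close> and \<open>height s\<close> is the largest level of a state
  reachable from input \<open>s\<close>, then
  \<open>|Z| = \<Sum>s. height s\<close>.

  Lower bound: by induction on the level, every impulse response to input \<open>s\<close> is annihilated by the
  polynomial \<open>X^(height s)\<close> times the characteristic polynomials of the heterogeneous blocks below
  \<open>s\<close>, evaluated at the shift operator. Hence the rank of the output controllability matrix is at
  most the sum of the degrees of these polynomials, which is at most \<open>|Z| + S * n_M\<close>.

  Upper bound: realize a spanning forest in which each input has one branch \<open>U\<close> of maximal length,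
  keep the branches unmodified, and give the other subsystems self-loops with distinct nonzero
  eigenvalues. The responses, whose transfer functions are products of factors \<open>1 / (z - \<lambda>)\<close> along
  the branches of the forest, are linearly independent.\<close>

subsection \<open>Row rank\<close>

text \<open>Forward: \<open>n\<close> independent columns form an invertible matrix, and a vector
  orthogonal to all columns lies in the kernel of its transpose. Backward: over the reals the Gram
  matrix of the rows inherits the trivial kernel, so it is invertible, and every vector becomes a
  combination of columns.\<close>

lemma full_row_rank_iff:
  fixes M :: "real mat"
  assumes M: "M \<in> carrier_mat n c"
  shows "vec_space.rank n M = n \<longleftrightarrow>
    (\<forall>w\<in>carrier_vec n. M\<^sup>T *\<^sub>v w = 0\<^sub>v c \<longrightarrow> w = 0\<^sub>v n)"
proof -
  interpret vec_space "TYPE(real)" n .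
  show ?thesis
  proof
    assume rank: "rank M = n"
    let ?P = "\<lambda>T. T \<subseteq> set (cols M) \<and> lin_indpt T"
    have "?P {}"
      by (metis empty_subsetI finite_basis_exists fin_dim subset_li_is_li basis_def)
    then obtain S where S: "finite S" "maximal S ?P"
      using maximal_exists_superset[of "set (cols M)" ?P "{}"] by auto
    then have card_S: "card S = n"
      using rank_card_indpt[OF M] rank by auto
    have S_P: "S \<subseteq> set (cols M)" "lin_indpt S" 
      using S(2) by (auto simp: maximal_def)
    obtain cs where cs: "set cs = S" "distinct cs"
      using S(1) finite_distinct_list by blast
    have cols_car: "set (cols M) \<subseteq> carrier_vec n"
      using M cols_dim by blast
    define D where "D = mat_of_cols n cs"
    have "length cs = n"
      using distinct_card[OF cs(2)] unfolding cs(1) card_S by (rule sym)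
    then have D: "D \<in> carrier_mat n n"
      unfolding D_def using mat_of_cols_carrier(1)[of n cs] by simp
    have cols_D: "cols D = cs"
      unfolding D_def using cs S_P cols_car by (intro cols_mat_of_cols) auto
    have "rank D = n"
      using lin_indpt_full_rank[OF D] cols_D cs S_P by simp
    then have "det D \<noteq> 0"
      using det_rank_iff[OF D] by simp
    then have det: "det D\<^sup>T \<noteq> 0"
      using det_transpose[OF D] by simp
    show "\<forall>w\<in>carrier_vec n. M\<^sup>T *\<^sub>v w = 0\<^sub>v c \<longrightarrow> w = 0\<^sub>v n"
    proof (intro ballI impI)
      fix w :: "real vec"
      assume w: "w \<in> carrier_vec n" "M\<^sup>T *\<^sub>v w = 0\<^sub>v c"
      have orth: "v \<bullet> w = 0" if "v \<in> set (cols M)" for v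
      proof -
        from that obtain j where j: "j < c" "v = col M j"
          using M by (metis carrier_matD(2) cols_length cols_nth in_set_conv_nth)
        have "(M\<^sup>T *\<^sub>v w) $ j = 0"
          using w(2) j by simp
        then show ?thesis
          using j M by simp
      qed
      have "D\<^sup>T *\<^sub>v w = 0\<^sub>v n"
      proof (rule eq_vecI)
        fix j assume "j < dim_vec (0\<^sub>v n :: real vec)"
        then have j: "j < n" by simp
        then have "col D j \<in> set (cols M)"
          using cols_D cs S_P D by (metis carrier_matD(2) cols_length cols_nth nth_mem subsetD)
        then show "(D\<^sup>T *\<^sub>v w) $ j = 0\<^sub>v n $ j"
          using j D orth by simp
      qed (use D in auto)
      then show "w = 0\<^sub>v n"
        using det det_0_iff_vec_prod_zero_field[of "D\<^sup>T" n] D w(1) by auto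
    qed
  next
    assume ker: "\<forall>w\<in>carrier_vec n. M\<^sup>T *\<^sub>v w = 0\<^sub>v c \<longrightarrow> w = 0\<^sub>v n"
    let ?G = "M * M\<^sup>T"
    have G: "?G \<in> carrier_mat n n"
      using M by simp
    have inj: "w = 0\<^sub>v n" if w: "w \<in> carrier_vec n" "?G *\<^sub>v w = 0\<^sub>v n" for w
    proof -
      let ?u = "M\<^sup>T *\<^sub>v w"
      have u: "?u \<in> carrier_vec c"
        using M w by simp
      \<comment> \<open>The squared norm of \<open>?u\<close> is the quadratic form of
        \<open>?G\<close> at \<open>w\<close>, so the kernel of \<open>?G\<close> is contained in
        that of the transpose of \<open>M\<close>.\<close>
      have "?u \<bullet> ?u = (M *\<^sub>v ?u) \<bullet> w"
        using transpose_vec_mult_scalar[OF M u w(1)] M u w(1)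
        by (simp add: comm_scalar_prod[of w n])
      also have "M *\<^sub>v ?u = ?G *\<^sub>v w"
        using M w by (simp add: assoc_mult_mat_vec[of M n c])
      finally have "?u \<bullet> ?u = 0"
        using w by simp
      then have "?u \<bullet>c ?u = 0"
        by (simp add: conjugate_vec_def)
      then have "?u = 0\<^sub>v c"
        using conjugate_square_eq_0_vec[OF u] by simp
      then show ?thesis
        using ker w by blast
    qed
    then have "det ?G \<noteq> 0"
      using det_0_iff_vec_prod_zero_field[OF G] by auto
    then have "?G \<in> Units (ring_mat TYPE(real) n ())"
      using det_non_zero_imp_unit[OF G] by auto
    then obtain H where H: "H \<in> carrier_mat n n" "?G * H = 1\<^sub>m n"
      by (auto simp: Units_def ring_mat_def)
    have "x \<in> span (set (cols M))" if x: "x \<in> carrier_vec n" for x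
    proof -
      have "M *\<^sub>v (M\<^sup>T *\<^sub>v (H *\<^sub>v x)) = (?G * H) *\<^sub>v x"
      proof -
        have y: "H *\<^sub>v x \<in> carrier_vec n"
          using H(1) x by simp
        have "?G *\<^sub>v (H *\<^sub>v x) = M *\<^sub>v (M\<^sup>T *\<^sub>v (H *\<^sub>v x))"
          using M y by (intro assoc_mult_mat_vec[of M n c]) auto
        then show ?thesis
          using assoc_mult_mat_vec[OF G H(1) x] by simp
      qed
      also have "\<dots> = x"
        using H x by simp
      finally have "x \<in> col_space M"
        unfolding col_space_eq[OF M] using M H x
        by (auto intro!: bexI[of _ "M\<^sup>T *\<^sub>v (H *\<^sub>v x)"])
      then show ?thesis
        by (simp add: col_space_def)
    qed
    moreover have "span (set (cols M)) \<subseteq> carrier_vec n"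
      using M cols_dim span_closed by blast
    ultimately have "span (set (cols M)) = carrier_vec n"
      by blast
    moreover have "vs (carrier_vec n) = V"
      by (simp add: module_vec_def)
    ultimately show "rank M = n"
      using dim_is_n unfolding rank_def by (simp only:)
  qed
qed

text \<open>Fewer than \<open>n\<close> homogeneous linear equations in \<open>n\<close> unknowns
  have a nonzero solution.\<close>

lemma orthogonal_vector_exists:
  fixes f :: "'i \<Rightarrow> nat \<Rightarrow> real"
  assumes "finite I" "card I < n"
  obtains w where "\<exists>j<n. w j \<noteq> 0" "\<And>i. i \<in> I \<Longrightarrow> (\<Sum>j<n. w j * f i j) = 0"
proof -
  obtain e where e: "bij_betw e {..<card I} I"
    using ex_bij_betw_nat_finite[OF assms(1)] by (auto simp: atLeast0LessThan)
  \<comment> \<open>Zero rows pad the system to a square one. Row \<open>card I\<close> is among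
    them, so a unit vector lies in the kernel of the transpose and the determinant vanishes.\<close>
  define M where "M = mat n n (\<lambda>(r, j). if r < card I then f (e r) j else 0)"
  have M: "M \<in> carrier_mat n n"
    by (simp add: M_def)
  have "M\<^sup>T *\<^sub>v unit_vec n (card I) = 0\<^sub>v n"
    using assms(2) by (intro eq_vecI) (auto simp: M_def scalar_prod_def unit_vec_def)
  moreover have "unit_vec n (card I) \<noteq> (0\<^sub>v n :: real vec)"
    using assms(2) by simp
  ultimately have "det M\<^sup>T = 0"
    using det_0_iff_vec_prod_zero_field[of "M\<^sup>T" n] M unit_vec_carrier[of n "card I"]
    by (metis transpose_carrier_mat)
  then have "det M = 0"
    using det_transpose[OF M] by simp
  then obtain v where v: "v \<in> carrier_vec n" "v \<noteq> 0\<^sub>v n" "M *\<^sub>v v = 0\<^sub>v n"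
    using det_0_iff_vec_prod_zero_field[OF M] by blast
  show thesis
  proof
    show "\<exists>j<n. v $ j \<noteq> 0"
    proof (rule ccontr)
      assume "\<not> ?thesis"
      then have "v = 0\<^sub>v n"
        using v(1) by (intro eq_vecI) auto
      with v(2) show False ..
    qed
    fix i assume "i \<in> I"
    then have "i \<in> e ` {..<card I}"
      using e by (simp add: bij_betw_def)
    then obtain r where r: "r < card I" "e r = i"
      by blast
    have "(M *\<^sub>v v) $ r = 0"
      using v(3) r assms(2) by simp
    then show "(\<Sum>j<n. v $ j * f i j) = 0"
      using r assms(2) v(1)
      by (simp add: M_def scalar_prod_def atLeast0LessThan mult.commute)
  qed
qed

subsection \<open>Polynomials in the shift operator\<close>

text \<open>This is \<open>p\<close> evaluated at the forward shift operator and applied to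
  \<open>f\<close>. It vanishes identically iff \<open>f\<close> obeys the linear recurrence with
  characteristic polynomial \<open>p\<close>.\<close>

definition shift_act :: "'a::comm_ring_1 poly \<Rightarrow> (nat \<Rightarrow> 'a) \<Rightarrow> nat \<Rightarrow> 'a" where
  "shift_act p f t = (\<Sum>i\<le>degree p. coeff p i * f (t + i))"

lemma shift_act_altdef: "degree p \<le> d \<Longrightarrow> shift_act p f t = (\<Sum>i\<le>d. coeff p i * f (t + i))"
  unfolding shift_act_def by (rule sum.mono_neutral_left) (auto simp: coeff_eq_0)

lemma shift_act_0 [simp]: "shift_act 0 f t = 0"
  by (simp add: shift_act_def)

lemma shift_act_pCons: "shift_act (pCons a p) f t = a * f t + shift_act p f (Suc t)"
proof -
  have "shift_act (pCons a p) f t = (\<Sum>i\<le>Suc (degree p). coeff (pCons a p) i * f (t + i))"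
    by (rule shift_act_altdef) (simp add: degree_pCons_le)
  then show ?thesis
    by (simp only: sum.atMost_Suc_shift) (simp add: shift_act_def)
qed

lemma shift_act_1 [simp]: "shift_act 1 f = f"
  by (rule ext) (simp add: shift_act_def)

lemma shift_act_add: "shift_act (p + q) f t = shift_act p f t + shift_act q f t"
  by (simp add: shift_act_altdef[of _ "max (degree p) (degree q)"] degree_add_le algebra_simps
      sum.distrib)

lemma shift_act_smult: "shift_act (smult a p) f t = a * shift_act p f t"
  by (simp add: shift_act_altdef[of _ "degree p"] degree_smult_le sum_distrib_left mult.assoc)

text \<open>Products of polynomials become compositions of operators; this makes sequences a module
  over the polynomial ring, in which annihilators can be multiplied and commuted.\<close>

lemma shift_act_mult: "shift_act (p * q) f = shift_act p (shift_act q f)"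
proof (rule ext)
  show "shift_act (p * q) f t = shift_act p (shift_act q f) t" for t
    by (induction p arbitrary: t) (simp_all add: shift_act_pCons shift_act_add shift_act_smult)
qed

lemma shift_act_sum_poly: "shift_act (\<Sum>i\<in>I. p i) f t = (\<Sum>i\<in>I. shift_act (p i) f t)"
  by (induction I rule: infinite_finite_induct) (simp_all add: shift_act_add)

lemma shift_act_scale: "shift_act p (\<lambda>t. c * f t) t = c * shift_act p f t"
  by (simp add: shift_act_def sum_distrib_left mult_ac)

lemma shift_act_sum: "shift_act p (\<lambda>t. \<Sum>i\<in>I. c i * f i t) t = (\<Sum>i\<in>I. c i * shift_act p (f i) t)"
  unfolding shift_act_def sum_distrib_left by (subst sum.swap) (simp add: mult_ac)

lemma shift_act_sum_seq: "shift_act p (\<lambda>t. \<Sum>i\<in>I. f i t) t = (\<Sum>i\<in>I. shift_act p (f i) t)"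
  using shift_act_sum[where c = "\<lambda>_. 1"] by simp

lemma shift_act_zero_seq [simp]: "shift_act p (\<lambda>_. 0) t = 0"
  by (simp add: shift_act_def)

lemma shift_act_dvd_zero:
  assumes "q dvd p" "\<And>t. shift_act q f t = 0"
  shows "shift_act p f t = 0"
proof -
  from assms(1) obtain r where "p = r * q"
    by (auto simp: dvd_def mult.commute)
  moreover have "shift_act q f = (\<lambda>_. 0)"
    using assms(2) by blast
  ultimately show ?thesis
    by (simp add: shift_act_mult)
qed

text \<open>A monic recurrence expresses each value through the \<open>degree Q\<close> preceding
  ones.\<close>

lemma recurrence_zero:
  assumes "lead_coeff Q = 1" "\<And>t. shift_act Q f t = 0" "\<And>t. t < degree Q \<Longrightarrow> f t = 0"
  shows "f t = 0"
proof (induction t rule: less_induct)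
  case (less t)
  show ?case
  proof (cases "t < degree Q")
    case False
    let ?d = "degree Q"
    have "0 = (\<Sum>i\<le>?d. coeff Q i * f ((t - ?d) + i))"
      \<comment> \<open>Started at \<open>t - ?d\<close>, the recurrence has \<open>f t\<close> as
        its top term, and all other terms vanish by induction.\<close>
      using assms(2)[of "t - ?d"] by (simp add: shift_act_def)
    also have "\<dots> = (\<Sum>i\<in>{?d}. coeff Q i * f ((t - ?d) + i))"
    proof (rule sum.mono_neutral_right)
      show "\<forall>i\<in>{..?d} - {?d}. coeff Q i * f (t - ?d + i) = 0"
      proof
        fix i assume "i \<in> {..?d} - {?d}"
        then have "t - ?d + i < t"
          using False by auto
        then show "coeff Q i * f (t - ?d + i) = 0"
          using less by simp
      qed
    qed auto
    also have "\<dots> = f t"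
      using assms(1) False by simp
    finally show ?thesis by simp
  qed (use assms(3) in simp)
qed

text \<open>A Cayley-Hamilton argument with forcing term: the matrix \<open>X I - a\<close>, with
  the shift for \<open>X\<close>, maps the vector of sequences \<open>x\<close> to \<open>g\<close>.
  Multiplying by its adjugate turns the left side into the characteristic polynomial acting on each
  component, and \<open>Q\<close> commutes with the adjugate entries and kills
  \<open>g\<close>.\<close>

lemma char_poly_kills:
  fixes a :: "'a::field mat"
  assumes a: "a \<in> carrier_mat d d"
    and g: "\<And>p t. p < d \<Longrightarrow> x p (Suc t) = (\<Sum>q<d. a $$ (p, q) * x q t) + g p t"
    and Q: "\<And>p t. p < d \<Longrightarrow> shift_act Q (g p) t = 0"
    and p: "p < d"
  shows "shift_act (Q * char_poly a) (x p) t = 0"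
proof -
  let ?M = "char_poly_matrix a"
  let ?J = "adj_mat ?M"
  have M: "?M \<in> carrier_mat d d"
    using a by simp
  note J = adj_mat[OF M]
  have M_act: "(\<Sum>r<d. shift_act (?M $$ (q, r)) (x r) t) = g q t" if q: "q < d" for q t
  proof -
    have "shift_act (?M $$ (q, r)) (x r) t = (if r = q then x q (Suc t) else 0) - a $$ (q, r) * x r t"
      if "r < d" for r
      using that q a by (simp add: char_poly_matrix_def shift_act_pCons)
    then have "(\<Sum>r<d. shift_act (?M $$ (q, r)) (x r) t) =
        (\<Sum>r<d. (if r = q then x q (Suc t) else 0) - a $$ (q, r) * x r t)"
      by simp
    also have "\<dots> = g q t"
      using q g[OF q] by (simp add: sum_subtractf)
    finally show ?thesis .
  qed
  have entry: "(\<Sum>q<d. ?J $$ (p, q) * ?M $$ (q, r)) = (if r = p then char_poly a else 0)"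
    if r: "r < d" for r
  proof -
    have "(?J * ?M) $$ (p, r) = (\<Sum>q<d. ?J $$ (p, q) * ?M $$ (q, r))"
      using p r J(1) M by (simp add: scalar_prod_def atLeast0LessThan)
    moreover have "(?J * ?M) $$ (p, r) = (if r = p then char_poly a else 0)"
      using p r by (simp add: J(3) char_poly_def)
    ultimately show ?thesis
      by simp
  qed
  have chi: "shift_act (char_poly a) (x p) t = (\<Sum>q<d. shift_act (?J $$ (p, q)) (g q) t)" for t
  proof -
    have "shift_act (char_poly a) (x p) t =
        (\<Sum>r<d. shift_act (\<Sum>q<d. ?J $$ (p, q) * ?M $$ (q, r)) (x r) t)"
      using p by (simp add: entry if_distrib[of "\<lambda>c. shift_act c _ _"] cong: if_cong)
    also have "\<dots> = (\<Sum>r<d. \<Sum>q<d. shift_act (?J $$ (p, q)) (shift_act (?M $$ (q, r)) (x r)) t)"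
      by (simp add: shift_act_sum_poly shift_act_mult)
    also have "\<dots> = (\<Sum>q<d. shift_act (?J $$ (p, q)) (\<lambda>t. \<Sum>r<d. shift_act (?M $$ (q, r)) (x r) t) t)"
      unfolding shift_act_sum_seq by (rule sum.swap)
    also have "\<dots> = (\<Sum>q<d. shift_act (?J $$ (p, q)) (g q) t)"
    proof (rule sum.cong[OF refl])
      fix q assume "q \<in> {..<d}"
      then have "(\<lambda>t. \<Sum>r<d. shift_act (?M $$ (q, r)) (x r) t) = g q"
        using M_act by auto
      then show "shift_act (?J $$ (p, q)) (\<lambda>t. \<Sum>r<d. shift_act (?M $$ (q, r)) (x r) t) t =
          shift_act (?J $$ (p, q)) (g q) t"
        by simp
    qed
    finally show ?thesis .
  qed
  then have "shift_act (char_poly a) (x p) = (\<lambda>t. \<Sum>q<d. shift_act (?J $$ (p, q)) (g q) t)"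
    by (simp add: fun_eq_iff)
  then have "shift_act (Q * char_poly a) (x p) t = (\<Sum>q<d. shift_act Q (shift_act (?J $$ (p, q)) (g q)) t)"
    by (simp only: shift_act_mult shift_act_sum_seq)
  also have "\<dots> = (\<Sum>q<d. shift_act (?J $$ (p, q) * Q) (g q) t)"
    by (simp only: shift_act_mult[symmetric] mult.commute)
  also have "\<dots> = 0"
    using Q by (intro sum.neutral) (auto intro: shift_act_dvd_zero[of Q])
  finally show ?thesis .
qed

subsection \<open>Block indices and Markov parameters\<close>

lemma sum_offset: "(\<Sum>b<offset k n. f b) = (\<Sum>j<n. \<Sum>q<k j. f (offset k j + q))"
  for f :: "nat \<Rightarrow> 'a::comm_monoid_add"
proof (induction n)
  case 0
  then show ?case by (simp add: offset_def)
next
  case (Suc n)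
  have split: "(\<Sum>b<c + d. f b) = (\<Sum>b<c. f b) + (\<Sum>q<d. f (c + q))" for c d
    by (induction d) (simp_all add: add.assoc)
  have "(\<Sum>b<offset k (Suc n). f b) = (\<Sum>b<offset k n + k n. f b)"
    by (simp add: offset_def)
  also have "\<dots> = (\<Sum>b<offset k n. f b) + (\<Sum>q<k n. f (offset k n + q))"
    by (rule split)
  finally show ?case
    using Suc by simp
qed

lemma offset_mono: "i \<le> j \<Longrightarrow> offset k i \<le> offset k j"
  unfolding offset_def by (rule sum_mono2) auto

lemma offset_less:
  assumes "i < n" "p < k i"
  shows "offset k i + p < offset k n"
proof -
  have "offset k i + p < offset k (Suc i)"
    using assms(2) by (simp add: offset_def)
  also have "\<dots> \<le> offset k n"
    using assms(1) by (intro offset_mono) simp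
  finally show ?thesis .
qed

definition block_of :: "(nat \<Rightarrow> nat) \<Rightarrow> nat \<Rightarrow> nat" where
  "block_of k a = (LEAST i. a < offset k (Suc i))"

lemma block_of_offset [simp]:
  assumes "p < k i"
  shows "block_of k (offset k i + p) = i"
  unfolding block_of_def
proof (rule Least_equality)
  show "offset k i + p < offset k (Suc i)"
    using assms by (simp add: offset_def)
  fix j assume "offset k i + p < offset k (Suc j)"
  then show "i \<le> j"
    using offset_mono[of "Suc j" i k] by (cases "i \<le> j") auto
qed

lemma block_cases:
  assumes "a < offset k n"
  obtains i p where "i < n" "p < k i" "a = offset k i + p"
proof -
  have "\<exists>i<n. \<exists>p<k i. a = offset k i + p"
    using assms
  proof (induction n)
    case 0
    then show ?case by (simp add: offset_def)
  next
    case (Suc n)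
    show ?case
    proof (cases "a < offset k n")
      case True
      then show ?thesis
        using Suc.IH less_SucI by blast
    next
      case False
      then have "a - offset k n < k n" "a = offset k n + (a - offset k n)"
        using Suc.prems by (auto simp: offset_def)
      then show ?thesis
        by blast
    qed
  qed
  then show thesis
    using that by blast
qed

text \<open>The impulse response follows the state recursion without input.\<close>

lemma markov_Suc:
  fixes A :: "real mat"
  assumes A: "A \<in> carrier_mat N N" and B: "B \<in> carrier_mat N m" and a: "a < N" and s: "s < m"
  shows "(A ^\<^sub>m Suc t * B) $$ (a, s) = (\<Sum>b<N. A $$ (a, b) * (A ^\<^sub>m t * B) $$ (b, s))"
proof -
  \<comment> \<open>The library power appends the new factor on the right, whereas the recursion
    needs it on the left.\<close>
  have comm: "A ^\<^sub>m Suc t = A * A ^\<^sub>m t" for t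
  proof (induction t)
    case 0
    show ?case using A by simp
  next
    case (Suc t)
    have "A ^\<^sub>m Suc (Suc t) = A * A ^\<^sub>m t * A"
      using Suc by simp
    also have "\<dots> = A * A ^\<^sub>m Suc t"
      using A by (simp add: assoc_mult_mat[OF A pow_carrier_mat[OF A] A])
    finally show ?case .
  qed
  have "A ^\<^sub>m Suc t * B = A * (A ^\<^sub>m t * B)"
    unfolding comm by (rule assoc_mult_mat[OF A pow_carrier_mat[OF A] B])
  also have "\<dots> $$ (a, s) = (\<Sum>b<N. A $$ (a, b) * (A ^\<^sub>m t * B) $$ (b, s))"
  proof -
    have "A ^\<^sub>m t * B \<in> carrier_mat N m"
      by (rule mult_carrier_mat[OF pow_carrier_mat[OF A] B])
    then show ?thesis
      using A B a s by (simp add: times_mat_def[of A] scalar_prod_def atLeast0LessThan)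
  qed
  finally show ?thesis .
qed

text \<open>Full row rank means that no nonzero functional \<open>w\<close> on the outputs
  annihilates all Markov parameters. Column \<open>t * m + s\<close> of the matrix is the output
  response to input \<open>s\<close> at time \<open>t\<close>.\<close>

lemma output_controllable_iff:
  assumes A: "A \<in> carrier_mat N N" and B: "B \<in> carrier_mat N m" and C: "C \<in> carrier_mat n N"
  shows "output_controllable A B C \<longleftrightarrow>
    (\<forall>w. (\<forall>s<m. \<forall>t<N. (\<Sum>i<n. w i * (\<Sum>b<N. C $$ (i, b) * (A ^\<^sub>m t * B) $$ (b, s))) = 0) \<longrightarrow>
      (\<forall>i<n. w i = 0))"
proof -
  let ?K = "ctrb_mat A B"
  define M where "M = C * ?K"
  let ?y = "\<lambda>i t s. \<Sum>b<N. C $$ (i, b) * (A ^\<^sub>m t * B) $$ (b, s)"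
  have K: "?K \<in> carrier_mat N (N * m)"
    using A B by (simp add: ctrb_mat_def)
  have M: "M \<in> carrier_mat n (N * m)"
    using C K by (simp add: M_def)
  have M_entry: "M $$ (i, t * m + s) = ?y i t s" if "i < n" "t < N" "s < m" for i t s
  proof -
    have "t * m + s < Suc t * m"
      using that by simp
    also have "\<dots> \<le> N * m"
      using that by (intro mult_le_mono1) simp
    finally have j: "t * m + s < N * m" .
    have "?K $$ (b, t * m + s) = (A ^\<^sub>m t * B) $$ (b, s)" if "b < N" for b
      using that j A B \<open>s < m\<close> by (simp add: ctrb_mat_def)
    then show ?thesis
      using that j C K by (simp add: M_def scalar_prod_def atLeast0LessThan)
  qed
  have kernel: "M\<^sup>T *\<^sub>v vec n w = 0\<^sub>v (N * m) \<longleftrightarrow> (\<forall>s<m. \<forall>t<N. (\<Sum>i<n. w i * ?y i t s) = 0)"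
    (is "?L \<longleftrightarrow> ?R") for w
  proof -
    have entry: "(M\<^sup>T *\<^sub>v vec n w) $ j = (\<Sum>i<n. w i * M $$ (i, j))" if "j < N * m" for j
      using that M by (simp add: scalar_prod_def atLeast0LessThan mult.commute)
    have "?L \<longleftrightarrow> (\<forall>j<N * m. (\<Sum>i<n. w i * M $$ (i, j)) = 0)"
    proof
      assume ?L
      then show "\<forall>j<N * m. (\<Sum>i<n. w i * M $$ (i, j)) = 0"
        using entry by (metis index_zero_vec(1))
    next
      assume "\<forall>j<N * m. (\<Sum>i<n. w i * M $$ (i, j)) = 0"
      then show ?L
        using entry M by (intro eq_vecI) auto
    qed
    also have "\<dots> \<longleftrightarrow> ?R"
    proof
      assume L: "\<forall>j<N * m. (\<Sum>i<n. w i * M $$ (i, j)) = 0"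
      show ?R
      proof (intro allI impI)
        fix s t assume st: "s < m" "t < N"
        have "t * m + s < Suc t * m"
          using st by simp
        also have "\<dots> \<le> N * m"
          using st by (intro mult_le_mono1) simp
        finally have "(\<Sum>i<n. w i * M $$ (i, t * m + s)) = 0"
          using L by blast
        then show "(\<Sum>i<n. w i * ?y i t s) = 0"
          using M_entry st by simp
      qed
    next
      assume R: ?R
      show "\<forall>j<N * m. (\<Sum>i<n. w i * M $$ (i, j)) = 0"
      proof (intro allI impI)
        fix j assume j: "j < N * m"
        then have "0 < m"
          by (cases m) auto
        then have jm: "j div m < N" "j mod m < m"
          using j by (auto simp: less_mult_imp_div_less)
        then have "M $$ (i, j) = ?y i (j div m) (j mod m)" if "i < n" for i
          using M_entry[of i "j div m" "j mod m"] that by simp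
        then show "(\<Sum>i<n. w i * M $$ (i, j)) = 0"
          using R jm by simp
      qed
    qed
    finally show ?thesis .
  qed
  have "output_controllable A B C \<longleftrightarrow> vec_space.rank n M = n"
    using C by (simp add: output_controllable_def M_def)
  also have "\<dots> \<longleftrightarrow> (\<forall>w\<in>carrier_vec n. M\<^sup>T *\<^sub>v w = 0\<^sub>v (N * m) \<longrightarrow> w = 0\<^sub>v n)"
    by (rule full_row_rank_iff[OF M])
  also have "\<dots> \<longleftrightarrow> (\<forall>w. M\<^sup>T *\<^sub>v vec n w = 0\<^sub>v (N * m) \<longrightarrow> (\<forall>i<n. w i = 0))"
  proof safe
    fix w :: "nat \<Rightarrow> real" and i
    assume "\<forall>w\<in>carrier_vec n. M\<^sup>T *\<^sub>v w = 0\<^sub>v (N * m) \<longrightarrow> w = 0\<^sub>v n"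
      "M\<^sup>T *\<^sub>v vec n w = 0\<^sub>v (N * m)" "i < n"
    then have "vec n w = 0\<^sub>v n"
      using vec_carrier by blast
    then have "vec n w $ i = 0\<^sub>v n $ i"
      by simp
    then show "w i = 0"
      using \<open>i < n\<close> by simp
  next
    fix w :: "real vec"
    assume *: "\<forall>w. M\<^sup>T *\<^sub>v vec n w = 0\<^sub>v (N * m) \<longrightarrow> (\<forall>i<n. w i = 0)"
      "w \<in> carrier_vec n" "M\<^sup>T *\<^sub>v w = 0\<^sub>v (N * m)"
    have "vec n (\<lambda>i. w $ i) = w"
      using *(2) by (intro eq_vecI) auto
    then have "\<forall>i<n. w $ i = 0"
      using *(1)[rule_format, of "\<lambda>i. w $ i"] *(3) by simp
    then show "w = 0\<^sub>v n"
      using *(2) by (intro eq_vecI) auto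
  qed
  finally show ?thesis
    unfolding kernel .
qed

subsection \<open>Levels of a Y-network\<close>

text \<open>\<open>comp i\<close> is the only input from which state \<open>i\<close> is reachable, and \<open>lev i\<close> is the number of
  states on a longest stem ending in \<open>i\<close>.\<close>

locale leveled =
  fixes n m :: nat and A B :: "entry mat" and comp lev :: "nat \<Rightarrow> nat"
  assumes A_carrier: "A \<in> carrier_mat n n" and B_carrier: "B \<in> carrier_mat n m"
    and comp_less: "i < n \<Longrightarrow> comp i < m"
    and edge_comp: "\<lbrakk>i < n; j < n; A $$ (i, j) = Free\<rbrakk> \<Longrightarrow> comp j = comp i"
    and edge_lev: "\<lbrakk>i < n; j < n; A $$ (i, j) = Free\<rbrakk> \<Longrightarrow> lev j < lev i"
    and input_comp: "\<lbrakk>i < n; s < m; B $$ (i, s) = Free\<rbrakk> \<Longrightarrow> s = comp i"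
    and lev_step: "i < n \<Longrightarrow> lev i = 1 \<and> B $$ (i, comp i) = Free \<or>
      (\<exists>j<n. A $$ (i, j) = Free \<and> lev i = Suc (lev j) \<and> lev j > 0)"
begin

text \<open>The inserted \<open>0\<close> is the height of an input that reaches no state.\<close>

definition height :: "nat \<Rightarrow> nat" where
  "height s = Max (insert 0 (lev ` {i. i < n \<and> comp i = s}))"

lemma lev_le_height: "i < n \<Longrightarrow> lev i \<le> height (comp i)"
  unfolding height_def by (rule Max_ge) auto

lemma height_attained:
  assumes "height s > 0"
  obtains i where "i < n" "comp i = s" "lev i = height s"
proof -
  have "height s \<in> insert 0 (lev ` {i. i < n \<and> comp i = s})"
    unfolding height_def by (rule Max_in) auto
  then show thesis
    using assms that by auto
qed

lemma lev_pos: "i < n \<Longrightarrow> lev i > 0"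
  using lev_step by fastforce

end

locale Y_net =
  fixes n m :: nat and A B :: "entry mat"
  assumes net: "network n m A B" and Y: "Y_network A B"
begin

lemma dims [simp]: "dim_row A = n" "dim_col A = n" "dim_row B = n" "dim_col B = m"
  using net by (auto simp: network_def)

lemma accessible: "i < n \<Longrightarrow> \<exists>p. stem A B p \<and> last p = State i"
  using Y by (auto simp: Y_network_def input_accessible_def state_nodes_def)

lemma last_in_stem: "stem A B p \<Longrightarrow> last p \<in> set p"
  by (simp add: stem_def)

lemma hd_in_stem: "stem A B p \<Longrightarrow> hd p \<in> set p"
  by (simp add: stem_def)

text \<open>Input-accessibility makes the set of all stems and cycles a covering one. Applying the
  Y-condition to this single set forbids the intersections for every pair at once.\<close>

lemma Y_all:
  defines "P \<equiv> {p. stem A B p \<or> cycle A B p}"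
  shows "\<not> stem_meets_cycle A B P" "\<not> stems_of_different_inputs_meet A B P"
proof -
  have "covers P (state_nodes A)"
    unfolding covers_def
  proof
    fix x assume "x \<in> state_nodes A"
    then obtain p where "stem A B p" "last p = x"
      using Y by (auto simp: Y_network_def input_accessible_def)
    then show "x \<in> (\<Union>p\<in>P. set p)"
      using last_in_stem by (auto simp: P_def)
  qed
  moreover have "\<forall>p\<in>P. stem A B p \<or> cycle A B p"
    by (simp add: P_def)
  ultimately show "\<not> stem_meets_cycle A B P" "\<not> stems_of_different_inputs_meet A B P"
    using Y unfolding Y_network_def by blast+
qed

lemma stem_cycle_disjoint: "stem A B p \<Longrightarrow> cycle A B c \<Longrightarrow> set p \<inter> set c = {}"
  using Y_all(1) unfolding stem_meets_cycle_def by blast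

lemma stems_disjoint: "stem A B p \<Longrightarrow> stem A B q \<Longrightarrow> hd p \<noteq> hd q \<Longrightarrow> set p \<inter> set q = {}"
  using Y_all(2) unfolding stems_of_different_inputs_meet_def by blast

lemma edge_nodes:
  assumes "edge A B x y"
  shows "x \<in> input_nodes B \<union> state_nodes A" "y \<in> state_nodes A"
  using assms by (cases x; cases y; auto simp: input_nodes_def state_nodes_def)+

text \<open>Every node after the first has an incoming edge, so only the first can be an
  input.\<close>

lemma stem_Cons:
  assumes "stem A B p"
  obtains s q where "p = Input s # q" "s < m" "q \<noteq> []" "set q \<subseteq> state_nodes A"
proof -
  obtain x q where p: "p = x # q" and "x \<in> input_nodes B"
    using assms by (cases p) (auto simp: stem_def)
  then obtain s where s: "x = Input s" "s < m"
    by (auto simp: input_nodes_def)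
  have "q \<noteq> []"
    using assms p s by (auto simp: stem_def state_nodes_def)
  moreover have "y \<in> state_nodes A" if y: "y \<in> set q" for y
  proof -
    obtain k where k: "k < length q" "y = q ! k"
      using y by (auto simp: in_set_conv_nth)
    have "successively (edge A B) p"
      using assms by (simp add: stem_def)
    then have "edge A B (p ! k) (p ! Suc k)"
      using p k by (intro successively_nth[of "edge A B" p]) auto
    then show ?thesis
      using edge_nodes(2) p k by simp
  qed
  ultimately show thesis
    using that p s by blast
qed

text \<open>If the new node were already on the stem, the part of the stem from there on would close
  up to a cycle meeting the stem.\<close>

lemma stem_snoc:
  assumes "stem A B p" "edge A B (last p) (State i)"
  shows "stem A B (p @ [State i])"
proof -
  have p: "p \<noteq> []" "distinct p" "successively (edge A B) p"
    using assms(1) by (auto simp: stem_def)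
  have "State i \<notin> set p"
  proof
    assume "State i \<in> set p"
    then obtain ys zs where split: "p = ys @ State i # zs"
      by (auto dest: split_list)
    have "cycle A B (State i # zs @ [State i])"
      using p assms(2) unfolding split cycle_def
      by (auto simp: successively_append_iff successively_Cons split: if_splits)
    then show False
      using stem_cycle_disjoint[OF assms(1)] split by fastforce
  qed
  moreover have "State i \<in> state_nodes A"
    using edge_nodes(2)[OF assms(2)] .
  ultimately show ?thesis
    using p assms by (auto simp: stem_def successively_append_iff)
qed

lemma stem_take:
  assumes "stem A B p" "0 < k" "k < length p"
  shows "stem A B (take (Suc k) p)" "last (take (Suc k) p) = p ! k"
proof -
  obtain s q where p: "p = Input s # q" "s < m" "set q \<subseteq> state_nodes A"
    using assms(1) by (rule stem_Cons)
  show last: "last (take (Suc k) p) = p ! k"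
    using assms(3) by (simp add: take_Suc_conv_app_nth)
  have "p ! k \<in> state_nodes A"
    using p assms(2,3) by (cases k) auto
  moreover have "successively (edge A B) (take (Suc k) p)"
    using assms(1) unfolding stem_def
    by (metis append_take_drop_id successively_append_iff)
  ultimately show "stem A B (take (Suc k) p)"
    using assms(1) last by (auto simp: stem_def)
qed

text \<open>The bound ensures that longest stems exist.\<close>

lemma stem_length: "stem A B p \<Longrightarrow> length p \<le> m + n"
proof -
  assume p: "stem A B p"
  then obtain s q where q: "p = Input s # q" "s < m" "set q \<subseteq> state_nodes A"
    by (rule stem_Cons)
  then have "set p \<subseteq> Input ` {..<m} \<union> State ` {..<n}"
    by (auto simp: state_nodes_def)
  then have "card (set p) \<le> card (Input ` {..<m} \<union> State ` {..<n})"
    by (intro card_mono) auto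
  also have "\<dots> \<le> card (Input ` {..<m}) + card (State ` {..<n})"
    by (rule card_Un_le)
  also have "\<dots> \<le> m + n"
    using card_image_le[of "{..<m}" Input] card_image_le[of "{..<n}" State] by simp
  finally show ?thesis
    using p distinct_card[of p] by (simp add: stem_def)
qed

section \<open>The input of a state and its longest stems\<close>

definition comp :: "nat \<Rightarrow> nat" where
  "comp i = (SOME s. \<exists>p. stem A B p \<and> last p = State i \<and> hd p = Input s)"

definition lev :: "nat \<Rightarrow> nat" where
  "lev i = Max ((\<lambda>p. length p - 1) ` {p. stem A B p \<and> last p = State i})"

text \<open>Stems of different inputs are disjoint, so all stems through one state start at the same
  input, which is therefore the chosen one.\<close>

lemma hd_stem:
  assumes p: "stem A B p" and i: "State i \<in> set p"
  shows "hd p = Input (comp i)"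
proof -
  have "i < n"
    using p i by (auto elim!: stem_Cons simp: state_nodes_def)
  then obtain q where q: "stem A B q" "last q = State i"
    using accessible by blast
  then obtain s where "hd q = Input s"
    by (auto elim!: stem_Cons)
  then have "\<exists>s p. stem A B p \<and> last p = State i \<and> hd p = Input s"
    using q by blast
  from someI_ex[OF this] have "\<exists>p. stem A B p \<and> last p = State i \<and> hd p = Input (comp i)"
    unfolding comp_def .
  then obtain r where r: "stem A B r" "last r = State i" "hd r = Input (comp i)"
    by blast
  then have "State i \<in> set r"
    using last_in_stem by fastforce
  then show ?thesis
    using stems_disjoint[OF p r(1)] r(3) i by auto
qed

lemma lev_finite: "finite ((\<lambda>p. length p - 1) ` {p. stem A B p \<and> last p = State i})"
  by (rule finite_subset[of _ "{..m + n}"]) (auto dest!: stem_length)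

lemma length_le_lev: "stem A B p \<Longrightarrow> last p = State i \<Longrightarrow> length p \<le> Suc (lev i)"
  using Max_ge[OF lev_finite, of "length p - 1" i] unfolding lev_def by fastforce

lemma lev_attained:
  assumes "i < n"
  obtains p where "stem A B p" "last p = State i" "length p = Suc (lev i)"
proof -
  have "lev i \<in> (\<lambda>p. length p - 1) ` {p. stem A B p \<and> last p = State i}"
    unfolding lev_def using accessible[OF assms] by (intro Max_in lev_finite) auto
  then show thesis
    using that by (fastforce simp: stem_def)
qed

text \<open>Appending \<open>i\<close> to a longest stem ending in \<open>j\<close> gives a stem
  again, with one more state and the same input.\<close>

lemma edge_State:
  assumes "i < n" "j < n" "A $$ (i, j) = Free"
  shows "comp j = comp i" "lev j < lev i"
proof -
  obtain p where p: "stem A B p" "last p = State j" "length p = Suc (lev j)"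
    using assms(2) by (rule lev_attained)
  have stem: "stem A B (p @ [State i])"
    using p assms by (intro stem_snoc) auto
  then show "lev j < lev i"
    using length_le_lev[OF stem] p(3) by simp
  have "State j \<in> set p"
    using p last_in_stem by fastforce
  then have "hd p = Input (comp j)" "hd (p @ [State i]) = Input (comp i)"
    using hd_stem[OF p(1)] hd_stem[OF stem] by auto
  then show "comp j = comp i"
    using p(1) by (simp add: stem_def)
qed

lemma leveled: "leveled n m A B comp lev"
proof
  show "A \<in> carrier_mat n n" "B \<in> carrier_mat n m"
    using net by (auto simp: network_def)
next
  fix i assume i: "i < n"
  then obtain p where p: "stem A B p" "last p = State i" "length p = Suc (lev i)"
    by (rule lev_attained)
  then have "State i \<in> set p"
    using last_in_stem by fastforce
  then have hd: "hd p = Input (comp i)"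
    using hd_stem[OF p(1)] by blast
  obtain s q where q: "p = Input s # q" "s < m" "q \<noteq> []" "set q \<subseteq> state_nodes A"
    using p(1) by (rule stem_Cons)
  show "comp i < m"
    using hd q by simp
  show "lev i = 1 \<and> B $$ (i, comp i) = Free \<or>
      (\<exists>j<n. A $$ (i, j) = Free \<and> lev i = Suc (lev j) \<and> lev j > 0)"
  \<comment> \<open>Either the longest stem has one state, fed directly by the input, or
    \<open>i\<close> has a predecessor \<open>j\<close> on it. The prefix ending in \<open>j\<close>
    gives \<open>lev i \<le> Suc (lev j)\<close>, and the edge gives the converse.\<close>
  proof (cases "butlast q")
    case Nil
    then have "q = [State i]"
      using q(1,3) p(2) by (metis append_butlast_last_id append_Nil last.simps)
    then show ?thesis
      using p q hd by (auto simp: stem_def)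
  next
    case (Cons y ys)
    obtain r x where r: "q = r @ [x]" 
      using q(3) by (cases q rule: rev_cases) auto
    then have x: "x = State i" and "r \<noteq> []"
      using p(2) q(1) Cons by auto
    then have "last r \<in> state_nodes A"
      using q(4) r last_in_set[of r] by auto
    then obtain j where j: "last r = State j" "j < n"
      by (auto simp: state_nodes_def)
    have "successively (edge A B) ((Input s # r) @ [State i])"
      using p(1) q(1) r x by (simp add: stem_def)
    then have "edge A B (State j) (State i)"
      using j \<open>r \<noteq> []\<close> by (simp only: successively_append_iff) simp
    then have free: "A $$ (i, j) = Free"
      by simp
    have "stem A B (take (Suc (length r)) p)" "last (take (Suc (length r)) p) = p ! length r"
      using stem_take[OF p(1), of "length r"] q(1) r \<open>r \<noteq> []\<close> by auto
    moreover have "take (Suc (length r)) p = Input s # r"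
      using q(1) r by simp
    moreover have "p ! length r = State j"
      using q(1) r j \<open>r \<noteq> []\<close> by (simp add: nth_append last_conv_nth nth_Cons')
    ultimately have "Suc (length r) \<le> Suc (lev j)"
      using length_le_lev[of "Input s # r" j] by simp
    moreover have "lev i = Suc (length r)"
      using p(3) q(1) r by simp
    ultimately show ?thesis
      using edge_State(2)[OF i j(2) free] free j(2) \<open>r \<noteq> []\<close>
      by (intro disjI2 exI[of _ j]) (cases r, auto)
  qed
next
  fix i s assume free: "i < n" "s < m" "B $$ (i, s) = Free"
  then have "stem A B [Input s, State i]"
    by (auto simp: stem_def input_nodes_def state_nodes_def)
  then show "s = comp i"
    using hd_stem[of "[Input s, State i]" i] by simp
qed (use edge_State in auto)

sublocale leveled n m A B comp lev
  by (rule leveled)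

text \<open>Level \<open>0\<close> for inputs makes levels increase strictly along every edge, since
  states have positive level.\<close>

fun node_lev :: "node \<Rightarrow> nat" where
  "node_lev (State i) = lev i"
| "node_lev (Input s) = 0"

lemma stem_sorted: "stem A B p \<Longrightarrow> sorted_wrt (\<lambda>x y. node_lev x < node_lev y) p"
proof -
  assume p: "stem A B p"
  have "node_lev x < node_lev y" if "edge A B x y" for x y
    using that edge_lev lev_pos by (cases x; cases y) auto
  then have "successively (\<lambda>x y. node_lev x < node_lev y) p"
    using p by (auto simp: stem_def elim: successively_mono)
  then show ?thesis
    by (subst (asm) successively_conv_sorted_wrt) (auto intro: transpI)
qed

lemma stem_inj:
  assumes "stem A B p" "x \<in> set p" "y \<in> set p" "node_lev x = node_lev y"
  shows "x = y"
proof -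
  obtain a b where ab: "a < length p" "x = p ! a" "b < length p" "y = p ! b"
    using assms by (auto simp: in_set_conv_nth)
  then have "a = b"
    using sorted_wrt_nth_less[OF stem_sorted[OF assms(1)], of a b]
      sorted_wrt_nth_less[OF stem_sorted[OF assms(1)], of b a] assms(4)
    by (cases a b rule: linorder_cases) auto
  then show ?thesis
    using ab by simp
qed

section \<open>The size of a maximal set covered by disjoint stems\<close>

lemma card_pairs: "card (SIGMA s:{..<m}. {1..height s}) = (\<Sum>s<m. height s)"
  by simp

text \<open>Disjoint stems include at most one per input, and a stem carries at most one state of
  each level. So a covered state is determined by its input and its level.\<close>

lemma stem_coverable_card_le:
  assumes "stem_coverable A B Z"
  shows "card Z \<le> (\<Sum>s<m. height s)"
proof -
  from assms obtain P where Z: "Z \<subseteq> state_nodes A" and P: "\<forall>p\<in>P. stem A B p"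
    "vertex_disjoint P" "covers P Z"
    by (auto simp: stem_coverable_def)
  define I where "I = {i. State i \<in> Z}"
  have Z_I: "Z = State ` I"
    using Z by (auto simp: I_def state_nodes_def)
  have I: "i < n" if "i \<in> I" for i
    using that Z by (auto simp: I_def state_nodes_def)
  have "inj_on (\<lambda>i. (comp i, lev i)) I"
  proof (rule inj_onI)
    fix i j assume ij: "i \<in> I" "j \<in> I" and eq: "(comp i, lev i) = (comp j, lev j)"
    have "State i \<in> (\<Union>p\<in>P. set p)" "State j \<in> (\<Union>p\<in>P. set p)"
      using ij P(3) by (auto simp: I_def covers_def)
    then obtain p q where pq: "p \<in> P" "State i \<in> set p" "q \<in> P" "State j \<in> set q"
      by blast
    then have stems: "stem A B p" "stem A B q"
      using P(1) by auto
    \<comment> \<open>Input nodes count for disjointness, so two members with a common input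
      coincide.\<close>
    have "hd p = hd q"
      using hd_stem[OF stems(1)] hd_stem[OF stems(2)] pq eq by auto
    then have "set p \<inter> set q \<noteq> {}"
      using hd_in_stem[OF stems(1)] hd_in_stem[OF stems(2)] by auto
    then have "p = q"
      using P(2) pq by (auto simp: vertex_disjoint_def pairwise_def)
    then show "i = j"
      using stem_inj[OF stems(1) pq(2), of "State j"] pq(4) eq by simp
  qed
  moreover have "(\<lambda>i. (comp i, lev i)) ` I \<subseteq> (SIGMA s:{..<m}. {1..height s})"
    using I comp_less lev_le_height lev_pos by (fastforce simp: Suc_le_eq)
  ultimately have "card I \<le> card (SIGMA s:{..<m}. {1..height s})"
    by (rule card_inj_on_le) simp
  then show ?thesis
    unfolding card_pairs Z_I using card_image_le[of I State] I
    by (metis card_image injI inj_on_subset node.inject(1) subset_UNIV)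
qed

text \<open>A longest stem for each input gives a disjoint family, because stems of different inputs
  never meet.\<close>

lemma stem_coverable_card_eq:
  obtains Z where "stem_coverable A B Z" "(\<Sum>s<m. height s) \<le> card Z"
proof -
  \<comment> \<open>Inputs of height \<open>0\<close> reach no state and so start no stem.\<close>
  define D where "D = {s. s < m \<and> height s > 0}"
  have "\<exists>p. stem A B p \<and> hd p = Input s \<and> length p = Suc (height s)" if "s \<in> D" for s
  proof -
    obtain i where i: "i < n" "comp i = s" "lev i = height s"
      using \<open>s \<in> D\<close> height_attained[of s] unfolding D_def by blast
    obtain p where "stem A B p" "last p = State i" "length p = Suc (lev i)"
      using i(1) by (rule lev_attained)
    then show ?thesis
      using hd_stem[of p i] last_in_stem[of p] i by auto
  qed
  then obtain \<sigma> where \<sigma>: "stem A B (\<sigma> s)" "hd (\<sigma> s) = Input s" "length (\<sigma> s) = Suc (height s)"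
    if "s \<in> D" for s
    by metis
  define Z where "Z = (\<Union>s\<in>D. set (\<sigma> s)) \<inter> state_nodes A"
  have disj: "set (\<sigma> s) \<inter> set (\<sigma> s') = {}" if "s \<in> D" "s' \<in> D" "s \<noteq> s'" for s s'
    using stems_disjoint that \<sigma> by simp
  have "vertex_disjoint (\<sigma> ` D)"
    unfolding vertex_disjoint_def pairwise_def using disj by blast
  then have "stem_coverable A B Z"
    unfolding stem_coverable_def using \<sigma>(1)
    by (intro conjI exI[of _ "\<sigma> ` D"]) (auto simp: covers_def Z_def)
  moreover have "card (SIGMA s:{..<m}. {1..height s}) \<le> card Z"
  proof (rule card_inj_on_le)
    show "finite Z"
      by (simp add: Z_def state_nodes_def)
    have s_D: "s \<in> D" if "s < m" "l \<in> {1..height s}" for s l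
      using that by (auto simp: D_def)
    show "inj_on (\<lambda>(s, l). \<sigma> s ! l) (SIGMA s:{..<m}. {1..height s})"
    proof (rule inj_onI, clarify)
      fix s l s' l'
      assume sl: "s < m" "l \<in> {1..height s}" "s' < m" "l' \<in> {1..height s'}"
        and eq: "\<sigma> s ! l = \<sigma> s' ! l'"
      have D: "s \<in> D" "s' \<in> D"
        using s_D sl by auto
      have "\<sigma> s ! l \<in> set (\<sigma> s)" "\<sigma> s' ! l' \<in> set (\<sigma> s')"
        using sl \<sigma>(3) D by (auto intro!: nth_mem)
      then have "s = s'"
        using disj D eq by fastforce
      moreover have "distinct (\<sigma> s)"
        using \<sigma>(1) D by (simp add: stem_def)
      ultimately show "s = s' \<and> l = l'"
        using eq sl \<sigma>(3) D by (auto simp: nth_eq_iff_index_eq)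
    qed
    show "(\<lambda>(s, l). \<sigma> s ! l) ` (SIGMA s:{..<m}. {1..height s}) \<subseteq> Z"
    proof (clarify)
      fix s l assume sl: "s < m" "l \<in> {1..height s}"
      then have D: "s \<in> D"
        using s_D by blast
      have l: "0 < l" "l < length (\<sigma> s)"
        using sl \<sigma>(3) D by auto
      have "\<sigma> s ! l \<in> state_nodes A"
        using stem_take[OF \<sigma>(1)[OF D] l] by (metis stem_def)
      then show "\<sigma> s ! l \<in> Z"
        using D nth_mem[OF l(2)] by (auto simp: Z_def)
    qed
  qed
  ultimately show thesis
    using that card_pairs by simp
qed

lemma max_stem_coverable_card:
  assumes "max_stem_coverable A B Z"
  shows "card Z = (\<Sum>s<m. height s)" "card Z < n"
proof -
  have Z: "stem_coverable A B Z"
    using assms by (simp add: max_stem_coverable_def)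
  obtain Z' where "stem_coverable A B Z'" "(\<Sum>s<m. height s) \<le> card Z'"
    by (rule stem_coverable_card_eq)
  then have "(\<Sum>s<m. height s) \<le> card Z"
    using assms by (auto simp: max_stem_coverable_def intro: order_trans)
  then show "card Z = (\<Sum>s<m. height s)"
    using stem_coverable_card_le[OF Z] by simp
  have fin: "finite (state_nodes A)" and card: "card (state_nodes A) = n"
    by (auto simp: state_nodes_def card_image inj_on_def)
  have sub: "Z \<subseteq> state_nodes A"
    using Z by (simp add: stem_coverable_def)
  \<comment> \<open>A covering of all states must contain two distinct stems of one input; they
    share that input and so are not disjoint.\<close>
  have "Z \<noteq> state_nodes A"
  proof
    assume eq: "Z = state_nodes A"
    obtain P where P: "\<forall>p\<in>P. stem A B p" "vertex_disjoint P" "covers P Z"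
      using Z by (auto simp: stem_coverable_def)
    have "distinct_stems_of_same_input A B P"
      using Y P eq unfolding Y_network_def by blast
    then obtain p q where pq: "p \<in> P" "q \<in> P" "stem A B p" "stem A B q" "p \<noteq> q" "hd p = hd q"
      by (auto simp: distinct_stems_of_same_input_def)
    then have "set p \<inter> set q \<noteq> {}"
      using hd_in_stem[of p] hd_in_stem[of q] by auto
    then show False
      using P(2) pq by (auto simp: vertex_disjoint_def pairwise_def)
  qed
  then show "card Z < n"
    using psubset_card_mono[OF fin] sub card by blast
qed

end

subsection \<open>Lower bound\<close>

text \<open>Otherwise the degrees of the annihilating polynomials sum to less than \<open>n\<close>.
  Some nonzero \<open>w\<close> is then orthogonal to that many initial output samples, and the
  recurrences extend this to all times, against controllability.\<close>

lemma (in leveled) extended_order_bound: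
  assumes ext: "extended_system A B k Ah Bh Ch"
    and soc: "structurally_output_controllable Ah Bh Ch"
    and types: "\<forall>i<n. higher_order_heterogeneous k Ah i \<or> unmodified k Ah i"
    and k_le: "\<And>i. i < n \<Longrightarrow> k i \<le> K"
  shows "n \<le> (\<Sum>s<m. height s) + card {i. i < n \<and> higher_order_heterogeneous k Ah i} * K"
proof (rule ccontr)
  assume contra: "\<not> ?thesis"
  define N where "N = offset k n"
  have dims: "dim_row A = n" "dim_col B = m"
    using A_carrier B_carrier by auto
  note ext' = ext[unfolded extended_system_def Let_def dims, folded N_def]
  have car: "Ah \<in> carrier_mat N N" "Bh \<in> carrier_mat N m" "Ch \<in> carrier_mat n N"
    using ext' by simp_all
  note off_diag = ext'[THEN conjunct2, THEN conjunct2, THEN conjunct2, THEN conjunct2,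
      THEN conjunct1, rule_format]
  note input = ext'[THEN conjunct2, THEN conjunct2, THEN conjunct2, THEN conjunct2,
      THEN conjunct2, THEN conjunct1, rule_format]
  obtain A' B' C' where real: "realization Ah A'" "realization Bh B'" "realization Ch C'"
    and oc: "output_controllable A' B' C'"
    using soc by (auto simp: structurally_output_controllable_def)
  have A': "A' \<in> carrier_mat N N" and B': "B' \<in> carrier_mat N m" and C': "C' \<in> carrier_mat n N"
    using real car by (auto simp: realization_def)
  have fixed_A: "A' $$ (a, b) = c" if "a < N" "b < N" "Ah $$ (a, b) = Fixed c" for a b c
    using real(1) car that by (auto simp: realization_def)
  have fixed_B: "B' $$ (a, s) = c" if "a < N" "s < m" "Bh $$ (a, s) = Fixed c" for a s c
    using real(2) car that by (auto simp: realization_def)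
  have idx: "offset k i + p < N" if "i < n" "p < k i" for i p
    unfolding N_def using that by (rule offset_less)
  have A'_edge: "A $$ (i, j) = Free"
    if "i < n" "j < n" "i \<noteq> j" "p < k i" "q < k j" "A' $$ (offset k i + p, offset k j + q) \<noteq> 0"
    for i j p q
  proof (rule ccontr)
    assume "A $$ (i, j) \<noteq> Free"
    then have "Ah $$ (offset k i + p, offset k j + q) = Fixed 0"
      using off_diag[OF that(1,2,3,4,5)] by blast
    from fixed_A[OF idx[OF that(1,4)] idx[OF that(2,5)] this] that(6) show False
      by simp
  qed
  have B'_edge: "B $$ (i, s) = Free"
    if "i < n" "s < m" "p < k i" "B' $$ (offset k i + p, s) \<noteq> 0" for i s p
  proof (rule ccontr)
    assume "B $$ (i, s) \<noteq> Free"
    then have "Bh $$ (offset k i + p, s) = Fixed 0"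
      using input[OF that(1,2,3)] by blast
    from fixed_B[OF idx[OF that(1,3)] that(2) this] that(4) show False
      by simp
  qed
  define het where "het = higher_order_heterogeneous k Ah"
  have unmod: "k i = 1" "A' $$ (offset k i, offset k i) = 0" if "i < n" "\<not> het i" for i
  proof -
    have "unmodified k Ah i"
      using types that by (auto simp: het_def)
    then show "k i = 1" and "A' $$ (offset k i, offset k i) = 0"
      using fixed_A[of "offset k i" "offset k i" 0] idx[of i 0] that(1)
      by (auto simp: unmodified_def all_block_entries_def)
  qed

  \<comment> \<open>Impulse responses, split by subsystem\<close>
  define x where "x i p s t = (A' ^\<^sub>m t * B') $$ (offset k i + p, s)" for i p s t
  define a where "a i = mat (k i) (k i) (\<lambda>(p, q). A' $$ (offset k i + p, offset k i + q))" for i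
  \<comment> \<open>\<open>g\<close> is the inflow from the other subsystems, and \<open>a i\<close>
    the internal dynamics of subsystem \<open>i\<close>.\<close>
  define g where "g i p s t =
    (\<Sum>j\<in>{..<n} - {i}. \<Sum>q<k j. A' $$ (offset k i + p, offset k j + q) * x j q s t)" for i p s t
  have x_Suc: "x i p s (Suc t) = (\<Sum>q<k i. a i $$ (p, q) * x i q s t) + g i p s t"
    if "i < n" "p < k i" "s < m" for i p s t
  proof -
    have "x i p s (Suc t) =
        (\<Sum>b<N. A' $$ (offset k i + p, b) * (A' ^\<^sub>m t * B') $$ (b, s))"
      unfolding x_def using A' B' idx[OF that(1,2)] that(3) by (rule markov_Suc)
    also have "\<dots> = (\<Sum>j<n. \<Sum>q<k j. A' $$ (offset k i + p, offset k j + q) * x j q s t)"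
      unfolding N_def sum_offset x_def ..
    also have "\<dots> = (\<Sum>q<k i. A' $$ (offset k i + p, offset k i + q) * x i q s t) + g i p s t"
      unfolding g_def using that(1) by (intro sum.remove) auto
    finally show ?thesis
      using that(2) by (simp add: a_def)
  qed
  have x_0: "x i p s 0 = B' $$ (offset k i + p, s)" if "i < n" "p < k i" "s < m" for i p s
    using A' B' by (simp add: x_def)

  \<comment> \<open>All subsystems feeding \<open>i\<close> have the same input as \<open>i\<close>,
    so a different input \<open>s\<close> leaves them at rest.\<close>
  have x_other: "x i p s t = 0" if "i < n" "p < k i" "s < m" "comp i \<noteq> s" for i p s t
    using that
  proof (induction t arbitrary: i p)
    case 0
    then show ?case
      using x_0[of i p s] B'_edge[of i s p] input_comp[of i s] by auto
  next
    case (Suc t)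
    have "g i p s t = 0"
      unfolding g_def
    proof (intro sum.neutral ballI)
      fix j q assume j: "j \<in> {..<n} - {i}" and q: "q \<in> {..<k j}"
      show "A' $$ (offset k i + p, offset k j + q) * x j q s t = 0"
      proof (cases "A' $$ (offset k i + p, offset k j + q) = 0")
        case False
        then have "A $$ (i, j) = Free"
          using A'_edge[of i j p q] Suc.prems j q by auto
        then have "comp j \<noteq> s"
          using edge_comp[of i j] Suc.prems j by auto
        then show ?thesis
          using Suc.IH[of j q] Suc.prems(3) j q by simp
      qed simp
    qed
    then show ?case
      using x_Suc Suc by simp
  qed

  \<comment> \<open>Annihilating polynomials of the impulse responses\<close>
  define \<chi> where "\<chi> i = char_poly (a i)" for i
  define H where "H s l = {i. i < n \<and> comp i = s \<and> lev i \<le> l \<and> het i}" for s l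
  \<comment> \<open>All unmodified subsystems of one level share a single factor \<open>X\<close>,
    while each heterogeneous one contributes its own characteristic polynomial. This is why the
    degree counts levels and not unmodified subsystems.\<close>
  define Q where "Q s l = [:0, 1:] ^ l * (\<Prod>i\<in>H s l. \<chi> i)" for s l
  have fin_H: "finite (H s l)" for s l
    by (rule finite_subset[of _ "{..<n}"]) (auto simp: H_def)
  have a_car: "a i \<in> carrier_mat (k i) (k i)" for i
    by (simp add: a_def)
  have Q_mono: "Q s l dvd Q s l'" if "l \<le> l'" for s l l'
  proof -
    have "H s l \<subseteq> H s l'"
      using that by (auto simp: H_def)
    then show ?thesis
      unfolding Q_def using that fin_H
      by (intro mult_dvd_mono le_imp_power_dvd prod_dvd_prod_subset) auto
  qed
  \<comment> \<open>The inflow into \<open>i\<close> comes from lower levels and is killed by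
    \<open>Q\<close> one level below. Passing through \<open>i\<close> costs one more factor,
    \<open>\<chi> i\<close> or \<open>X\<close>.\<close>
  have kill: "shift_act (Q (comp i) (lev i)) (x i p (comp i)) t = 0" if "i < n" "p < k i" for i p t
    using that
  proof (induction "lev i" arbitrary: i p t rule: less_induct)
    case less
    let ?s = "comp i"
    obtain l where l: "lev i = Suc l"
      using lev_pos[OF less.prems(1)] gr0_conv_Suc by blast
    have s: "?s < m"
      using less.prems comp_less by simp
    have g: "shift_act (Q ?s l) (g i p ?s) t = 0" if p: "p < k i" for p t
    proof -
      have "shift_act (Q ?s l) (g i p ?s) t = (\<Sum>j\<in>{..<n} - {i}. \<Sum>q<k j.
          A' $$ (offset k i + p, offset k j + q) * shift_act (Q ?s l) (x j q ?s) t)"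
        unfolding g_def by (simp only: shift_act_sum_seq shift_act_scale)
      also have "\<dots> = 0"
      proof (intro sum.neutral ballI)
        fix j q assume j: "j \<in> {..<n} - {i}" and q: "q \<in> {..<k j}"
        show "A' $$ (offset k i + p, offset k j + q) * shift_act (Q ?s l) (x j q ?s) t = 0"
        proof (cases "A' $$ (offset k i + p, offset k j + q) = 0")
          case False
          then have "A $$ (i, j) = Free"
            using A'_edge[of i j p q] less.prems p j q by auto
          then have "comp j = ?s" "lev j < lev i"
            using edge_comp[of i j] edge_lev[of i j] less.prems j by auto
          moreover from this have "shift_act (Q ?s (lev j)) (x j q ?s) t = 0" for t
            using less.hyps[of j q t] j q by simp
          ultimately have "shift_act (Q ?s l) (x j q ?s) t = 0"
            using l by (auto intro: shift_act_dvd_zero[OF Q_mono[of "lev j" l ?s]])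
          then show ?thesis
            by simp
        qed simp
      qed
      finally show ?thesis .
    qed
    show ?case
    proof (cases "het i")
      case True
      \<comment> \<open>Since \<open>lev i = Suc l\<close>, the subsystem \<open>i\<close> is not
        yet in \<open>H ?s l\<close>, so \<open>\<chi> i\<close> is a new factor.\<close>
      have "Q ?s l * \<chi> i = [:0, 1:] ^ l * (\<Prod>j\<in>insert i (H ?s l). \<chi> j)"
        using fin_H l by (subst prod.insert) (auto simp: Q_def H_def mult_ac)
      also have "\<dots> dvd Q ?s (lev i)"
      proof -
        have "insert i (H ?s l) \<subseteq> H ?s (lev i)"
          using True l less.prems by (auto simp: H_def)
        then show ?thesis
          unfolding Q_def using l fin_H
          by (intro mult_dvd_mono le_imp_power_dvd prod_dvd_prod_subset) auto
      qed
      finally have dvd: "Q ?s l * \<chi> i dvd Q ?s (lev i)" .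
      have "shift_act (Q ?s l * \<chi> i) (x i p ?s) t = 0" for t
        unfolding \<chi>_def
        using x_Suc[OF less.prems(1) _ s] g less.prems(2)
        by (intro char_poly_kills[OF a_car, of _ "\<lambda>p. x i p ?s" "\<lambda>p. g i p ?s"]) auto
      then show ?thesis
        by (rule shift_act_dvd_zero[OF dvd])
    next
      case False
      then have k: "k i = 1" and a0: "A' $$ (offset k i, offset k i) = 0"
        using unmod less.prems by auto
      \<comment> \<open>Without a self-loop the response is the inflow delayed by one step.\<close>
      then have "x i p ?s (Suc t) = g i p ?s t" for t
        using x_Suc[OF less.prems s] less.prems(2) by (simp add: a_def)
      then have "shift_act [:0, 1:] (x i p ?s) = g i p ?s"
        by (simp add: shift_act_pCons fun_eq_iff)
      then have "shift_act (Q ?s l * [:0, 1:]) (x i p ?s) t = 0" for t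
        using g less.prems(2) by (simp only: shift_act_mult)
      moreover have "Q ?s l * [:0, 1:] dvd Q ?s (lev i)"
      proof -
        have "H ?s l \<subseteq> H ?s (lev i)"
          using l by (auto simp: H_def)
        then have "[:0, 1:] ^ lev i * (\<Prod>j\<in>H ?s l. \<chi> j) dvd Q ?s (lev i)"
          unfolding Q_def using fin_H by (intro mult_dvd_mono prod_dvd_prod_subset) auto
        then show ?thesis
          using l by (simp add: Q_def mult_ac)
      qed
      ultimately show ?thesis
        by (rule shift_act_dvd_zero[rotated])
    qed
  qed

  define d where "d s = height s + (\<Sum>i\<in>H s (height s). k i)" for s
  have Q_monic: "lead_coeff (Q s l) = 1" for s l
    using degree_monic_char_poly[OF a_car]
    by (simp add: Q_def lead_coeff_mult lead_coeff_power lead_coeff_prod \<chi>_def)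
  have Q_degree: "degree (Q s (height s)) = d s" for s
  proof -
    have "\<chi> i \<noteq> 0" for i
      using degree_monic_char_poly[OF a_car, of i] unfolding \<chi>_def by auto
    then have "degree (\<Prod>i\<in>H s (height s). \<chi> i) = (\<Sum>i\<in>H s (height s). k i)"
      "(\<Prod>i\<in>H s (height s). \<chi> i) \<noteq> 0"
      using degree_monic_char_poly[OF a_car] fin_H
      by (simp_all add: degree_prod_eq_sum_degree \<chi>_def)
    then show ?thesis
      by (simp add: Q_def d_def degree_mult_eq degree_power_eq)
  qed
  \<comment> \<open>One polynomial per input suffices: levels are bounded by the height, and states
    of other inputs do not respond.\<close>
  have kill': "shift_act (Q s (height s)) (\<lambda>t. (A' ^\<^sub>m t * B') $$ (b, s)) t = 0"
    if b: "b < N" and s: "s < m" for b s t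
  proof -
    obtain i p where ip: "i < n" "p < k i" "b = offset k i + p"
      using b unfolding N_def by (rule block_cases)
    then have eq: "(\<lambda>t. (A' ^\<^sub>m t * B') $$ (b, s)) = x i p s"
      by (simp add: x_def fun_eq_iff)
    show ?thesis
    proof (cases "comp i = s")
      case True
      then show ?thesis
        unfolding eq using kill[OF ip(1,2)] Q_mono[OF lev_le_height[OF ip(1)]]
        by (auto intro: shift_act_dvd_zero[of "Q s (lev i)"])
    next
      case False
      then have "x i p s = (\<lambda>_. 0)"
        using x_other ip s by (simp add: fun_eq_iff)
      then show ?thesis
        unfolding eq by simp
    qed
  qed

  \<comment> \<open>Counting the initial output samples\<close>
  let ?I = "SIGMA s:{..<m}. {..<d s}"
  \<comment> \<open>Each heterogeneous subsystem belongs to one input only, so its order is counted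
    once.\<close>
  have "(\<Sum>s<m. \<Sum>i\<in>H s (height s). k i) = (\<Sum>i\<in>(\<Union>s\<in>{..<m}. H s (height s)). k i)"
    using fin_H by (intro sum.UNION_disjoint[symmetric]) (auto simp: H_def)
  also have "\<dots> \<le> (\<Sum>i\<in>{i. i < n \<and> het i}. k i)"
    by (rule sum_mono2) (auto simp: H_def)
  also have "\<dots> \<le> card {i. i < n \<and> het i} * K"
    using k_le by (intro sum_bounded_above[of _ k K, simplified]) auto
  finally have "card ?I < n"
    using contra by (simp add: d_def sum.distrib het_def)
  then obtain w where w: "\<exists>i<n. w i \<noteq> 0"
    "\<And>st. st \<in> ?I \<Longrightarrow> (\<Sum>i<n. w i *
      (case st of (s, t) \<Rightarrow> \<Sum>b<N. C' $$ (i, b) * (A' ^\<^sub>m t * B') $$ (b, s))) = 0"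
    using orthogonal_vector_exists[of ?I n "\<lambda>st i.
      case st of (s, t) \<Rightarrow> \<Sum>b<N. C' $$ (i, b) * (A' ^\<^sub>m t * B') $$ (b, s)"]
    by blast
  have "(\<Sum>i<n. w i * (\<Sum>b<N. C' $$ (i, b) * (A' ^\<^sub>m t * B') $$ (b, s))) = 0"
    if s: "s < m" for s t
  proof -
    let ?y = "\<lambda>t. \<Sum>i<n. w i * (\<Sum>b<N. C' $$ (i, b) * (A' ^\<^sub>m t * B') $$ (b, s))"
    have "shift_act (Q s (height s)) ?y t = 0" for t
      using kill' s by (simp add: shift_act_sum)
    moreover have "?y t = 0" if "t < degree (Q s (height s))" for t
      using w(2)[of "(s, t)"] that s Q_degree by simp
    ultimately show ?thesis
      using recurrence_zero[OF Q_monic[of s "height s"], of ?y t] by simp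
  qed
  then show False
    using oc w(1) unfolding output_controllable_iff[OF A' B' C'] by blast
qed

subsection \<open>Upper bound\<close>

text \<open>\<open>par\<close> describes a spanning forest, and \<open>U\<close> consists of one branch of length \<open>height s\<close> for each
  input \<open>s\<close>.\<close>

locale spine = leveled +
  fixes par :: "nat \<Rightarrow> nat" and U :: "nat set"
  assumes par: "\<lbrakk>i < n; lev i > 1\<rbrakk> \<Longrightarrow> par i < n \<and> A $$ (i, par i) = Free \<and> lev i = Suc (lev (par i))"
    and U_less: "i \<in> U \<Longrightarrow> i < n"
    and U_par: "\<lbrakk>i \<in> U; lev i > 1\<rbrakk> \<Longrightarrow> par i \<in> U"
    and U_inj: "\<lbrakk>i \<in> U; j \<in> U; comp i = comp j; lev i = lev j\<rbrakk> \<Longrightarrow> i = j"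
    and card_U: "card U = (\<Sum>s<m. height s)"

text \<open>\<open>par\<close> selects a predecessor exactly one level lower, and the branch of
  input \<open>s\<close> follows \<open>par\<close> down from a state of maximal level.\<close>

lemma (in leveled) spine_exists:
  obtains par U where "spine n m A B comp lev par U"
proof -
  have "\<exists>j. i < n \<and> lev i > 1 \<longrightarrow> j < n \<and> A $$ (i, j) = Free \<and> lev i = Suc (lev j)" for i
    using lev_step[of i] by auto
  then obtain par where par: "par i < n" "A $$ (i, par i) = Free" "lev i = Suc (lev (par i))"
    if "i < n" "lev i > 1" for i
    by metis
  have "\<exists>i. height s > 0 \<longrightarrow> i < n \<and> comp i = s \<and> lev i = height s" for s
    using height_attained[of s] by metis
  then obtain top where top: "top s < n" "comp (top s) = s" "lev (top s) = height s"
    if "height s > 0" for s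
    by metis
  define f where "f s d = (par ^^ d) (top s)" for s d
  \<comment> \<open>Along the branch the level drops by one per step, so \<open>d\<close> is
    determined by the level and \<open>s\<close> by \<open>comp\<close>; hence \<open>f\<close> is
    injective.\<close>
  have f: "f s d < n \<and> comp (f s d) = s \<and> lev (f s d) = height s - d" if "d < height s" for s d
    using that
  proof (induction d)
    case 0
    then show ?case
      using top by (simp add: f_def)
  next
    case (Suc d)
    then have IH: "f s d < n" "comp (f s d) = s" "lev (f s d) = height s - d"
      by auto
    have "lev (f s d) > 1"
      using IH Suc.prems by simp
    note par[OF IH(1) this]
    moreover have "comp (par (f s d)) = s"
      using edge_comp[of "f s d" "par (f s d)"] par[OF IH(1) \<open>lev (f s d) > 1\<close>] IH by simp
    ultimately show ?case
      using IH Suc.prems by (simp add: f_def)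
  qed
  define U where "U = (\<lambda>(s, d). f s d) ` (SIGMA s:{..<m}. {..<height s})"
  have "inj_on (\<lambda>(s, d). f s d) (SIGMA s:{..<m}. {..<height s})"
  proof (rule inj_onI, clarify)
    fix s d s' d'
    assume sd: "d < height s" "d' < height s'" and eq: "f s d = f s' d'"
    have "s = s'"
      using f[OF sd(1)] f[OF sd(2)] eq by simp
    moreover from this have "d = d'"
      using f[OF sd(1)] f[OF sd(2)] eq sd by simp
    ultimately show "s = s' \<and> d = d'"
      by simp
  qed
  then have card: "card U = (\<Sum>s<m. height s)"
    unfolding U_def by (simp add: card_image)
  have "spine n m A B comp lev par U"
  proof
    fix i assume "i < n" "lev i > 1"
    then show "par i < n \<and> A $$ (i, par i) = Free \<and> lev i = Suc (lev (par i))"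
      using par by blast
  next
    fix i assume "i \<in> U"
    then show "i < n"
      using f by (auto simp: U_def)
  next
    fix i assume i: "i \<in> U" "lev i > 1"
    then obtain s d where sd: "s < m" "d < height s" "i = f s d"
      by (auto simp: U_def)
    then have "Suc d < height s"
      using f[of d s] i(2) by simp
    moreover have "par i = f s (Suc d)"
      using sd by (simp add: f_def)
    ultimately show "par i \<in> U"
      using sd(1) by (auto simp: U_def)
  next
    fix i j assume ij: "i \<in> U" "j \<in> U" and eq: "comp i = comp j" "lev i = lev j"
    obtain s d where sd: "d < height s" "i = f s d"
      using ij(1) by (auto simp: U_def)
    obtain s' d' where sd': "d' < height s'" "j = f s' d'"
      using ij(2) by (auto simp: U_def)
    have "s = s'"
      using f sd sd' eq(1) by auto
    moreover from this have "d = d'"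
      using f[OF sd(1)] f[OF sd'(1)] sd sd' eq(2) by auto
    ultimately show "i = j"
      using sd sd' by simp
  qed (rule card)
  then show thesis
    by (rule that)
qed

context spine
begin

section \<open>Branches of the spanning forest and responses along them\<close>

lemma par_comp: "i < n \<Longrightarrow> lev i > 1 \<Longrightarrow> comp (par i) = comp i"
  using par edge_comp by blast

text \<open>The branch from \<open>i\<close> down to level 1, including \<open>i\<close>. It stops
  after \<open>lev i\<close> states because \<open>par\<close> is unconstrained on level 1.\<close>

definition ancs :: "nat \<Rightarrow> nat set" where
  "ancs i = (\<lambda>d. (par ^^ d) i) ` {..<lev i}"

lemma funpow_par:
  assumes "i < n" "d < lev i"
  shows "(par ^^ d) i < n \<and> comp ((par ^^ d) i) = comp i \<and> lev ((par ^^ d) i) = lev i - d \<and>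
    (i \<in> U \<longrightarrow> (par ^^ d) i \<in> U)"
  using assms(2)
proof (induction d)
  case 0
  then show ?case using assms by simp
next
  case (Suc d)
  let ?j = "(par ^^ d) i"
  have j: "?j < n" "comp ?j = comp i" "lev ?j = lev i - d" "i \<in> U \<longrightarrow> ?j \<in> U"
    using Suc by auto
  then have "lev ?j > 1"
    using Suc.prems by simp
  then show ?case
    using par[of ?j] par_comp[of ?j] U_par[of ?j] j Suc.prems by auto
qed

lemma ancs_props:
  assumes "i < n" "j \<in> ancs i"
  shows "j < n" "comp j = comp i" "i \<in> U \<Longrightarrow> j \<in> U" "j \<noteq> i \<Longrightarrow> lev j < lev i"
proof -
  obtain d where d: "d < lev i" "j = (par ^^ d) i"
    using assms(2) by (auto simp: ancs_def)
  then show "j < n" "comp j = comp i" "i \<in> U \<Longrightarrow> j \<in> U"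
    using funpow_par[OF assms(1)] by auto
  assume "j \<noteq> i"
  then have "d > 0"
    using d by (cases d) auto
  then show "lev j < lev i"
    using funpow_par[OF assms(1) d(1)] d by simp
qed

lemma self_in_ancs: "i < n \<Longrightarrow> i \<in> ancs i"
  unfolding ancs_def using lev_pos[of i] by (intro image_eqI[of _ _ 0]) auto

lemma finite_ancs: "finite (ancs i)"
  by (simp add: ancs_def)

lemma card_ancs:
  assumes "i < n"
  shows "card (ancs i) = lev i"
proof -
  have "inj_on (\<lambda>d. (par ^^ d) i) {..<lev i}"
  proof (rule inj_onI)
    fix d e assume "d \<in> {..<lev i}" "e \<in> {..<lev i}" "(par ^^ d) i = (par ^^ e) i"
    then show "d = e"
      using funpow_par[OF assms, of d] funpow_par[OF assms, of e] by simp
  qed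
  then show ?thesis
    by (simp add: ancs_def card_image)
qed

lemma ancs_par:
  assumes "i < n" "lev i > 1"
  shows "ancs (par i) \<subseteq> ancs i - {i}"
proof
  fix j assume j: "j \<in> ancs (par i)"
  then obtain d where d: "d < lev (par i)" "j = (par ^^ d) (par i)"
    by (auto simp: ancs_def)
  have "j = (par ^^ Suc d) i" "Suc d < lev i"
    using d par[OF assms] by (simp_all add: funpow_swap1)
  then have "j \<in> ancs i"
    unfolding ancs_def by blast
  moreover have "lev j < lev i"
    using ancs_props(4)[of "par i" j] j par[OF assms] by (cases "j = par i") auto
  ultimately show "j \<in> ancs i - {i}"
    by auto
qed

text \<open>The self-loop gains: \<open>0\<close> on the unmodified branches, and pairwise distinct
  nonzero values elsewhere.\<close>

definition lam :: "nat \<Rightarrow> real" where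
  "lam i = (if i \<in> U then 0 else real (Suc i))"

text \<open>The response at time \<open>t\<close> of state \<open>i\<close> to an impulse at its own
  input, when the forest has unit edge gains and self-loops \<open>lam\<close>. Its transfer
  function is the product of \<open>1 / (z - lam j)\<close> over \<open>j\<close> in
  \<open>ancs i\<close>.\<close>

primrec resp :: "nat \<Rightarrow> nat \<Rightarrow> real" where
  "resp 0 = (\<lambda>i. if lev i = 1 then 1 else 0)"
| "resp (Suc t) = (\<lambda>i. lam i * resp t i + (if lev i > 1 then resp t (par i) else 0))"

definition lin :: "nat \<Rightarrow> real poly" where
  "lin i = [:- lam i, 1:]"

lemma shift_act_lin: "shift_act (lin i) (\<lambda>t. resp t i) = (\<lambda>t. if lev i > 1 then resp t (par i) else 0)"
  by (rule ext) (simp add: lin_def shift_act_pCons)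

text \<open>The impulse needs \<open>lev i - 1\<close> steps along the branch and first arrives with
  gain 1.\<close>

lemma resp_early: "i < n \<Longrightarrow> t < lev i \<Longrightarrow> resp t i = (if Suc t = lev i then 1 else 0)"
proof (induction t arbitrary: i)
  case (Suc t)
  then show ?case
    using par[of i] Suc.IH[of "par i"] Suc.IH[of i] by auto
qed auto

lemma shift_act_resp_low_degree:
  assumes "i < n" "degree p < lev i"
  shows "shift_act p (\<lambda>t. resp t i) 0 = coeff p (lev i - 1)"
proof -
  have "shift_act p (\<lambda>t. resp t i) 0 = (\<Sum>t\<le>lev i - 1. coeff p t * resp (0 + t) i)"
    using assms(2) by (intro shift_act_altdef) simp
  also have "\<dots> = (\<Sum>t\<le>lev i - 1. if t = lev i - 1 then coeff p t else 0)"
    using assms resp_early by (intro sum.cong) auto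
  finally show ?thesis
    by simp
qed

text \<open>The factor \<open>lin i\<close> turns the response of \<open>i\<close> into that of its
  parent, and at level 1 into zero; the remaining factors still contain the branch of the
  parent.\<close>

lemma shift_act_resp_zero:
  assumes "i < n" "finite J" "ancs i \<subseteq> J"
  shows "shift_act (\<Prod>j\<in>J. lin j) (\<lambda>t. resp t i) t = 0"
  using assms
proof (induction "lev i" arbitrary: i J t rule: less_induct)
  case less
  have "i \<in> J"
    using self_in_ancs less.prems by blast
  then have "(\<Prod>j\<in>J. lin j) = (\<Prod>j\<in>J - {i}. lin j) * lin i"
    using less.prems by (simp add: prod.remove mult.commute)
  then have eq: "shift_act (\<Prod>j\<in>J. lin j) (\<lambda>t. resp t i) =
      shift_act (\<Prod>j\<in>J - {i}. lin j) (\<lambda>t. if lev i > 1 then resp t (par i) else 0)"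
    by (simp only: shift_act_mult shift_act_lin)
  show ?case
  proof (cases "lev i > 1")
    case True
    have "shift_act (\<Prod>j\<in>J - {i}. lin j) (\<lambda>t. resp t (par i)) t = 0"
      using par[OF less.prems(1) True] ancs_par[OF less.prems(1) True] less.prems
      by (intro less.hyps) auto
    then show ?thesis
      using eq True by simp
  qed (use eq in simp)
qed

text \<open>Let \<open>p\<close> collect the factors of the proper ancestors and \<open>r\<close>
  the others. Modulo \<open>lin i\<close> the polynomial \<open>r\<close> is the constant
  \<open>poly r (lam i)\<close>, nonzero by the assumption on \<open>lam\<close>, and
  \<open>lin i * p\<close> kills the response. What remains is this constant times the action of
  \<open>p\<close>, which is 1.\<close>

lemma shift_act_resp_nonzero:
  assumes i: "i < n" and J: "finite J" "ancs i - {i} \<subseteq> J" "i \<notin> J"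
    and lam: "\<And>j. j \<in> J - ancs i \<Longrightarrow> lam j \<noteq> lam i"
  shows "shift_act (\<Prod>j\<in>J. lin j) (\<lambda>t. resp t i) 0 \<noteq> 0"
proof -
  define S where "S = ancs i - {i}"
  define p where "p = (\<Prod>j\<in>S. lin j)"
  define r where "r = (\<Prod>j\<in>J - S. lin j)"
  have S: "finite S" "card S = lev i - 1"
    using finite_ancs card_ancs[OF i] self_in_ancs[OF i] by (auto simp: S_def)
  have "poly r (lam i) = (\<Prod>j\<in>J - S. lam i - lam j)"
    by (simp add: r_def poly_prod lin_def)
  moreover have "lam i - lam j \<noteq> 0" if "j \<in> J - S" for j
    using lam[of j] that J(3) by (auto simp: S_def)
  ultimately have r: "poly r (lam i) \<noteq> 0"
    using J(1) by simp
  have "lin i dvd r - [:poly r (lam i):]"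
    unfolding lin_def by (simp add: poly_eq_0_iff_dvd[symmetric])
  then obtain q where "r - [:poly r (lam i):] = lin i * q"
    by (auto simp: dvd_def)
  then have r_eq: "r = lin i * q + [:poly r (lam i):]"
    by (simp add: algebra_simps)
  have "(\<Prod>j\<in>J. lin j) = p * r"
    unfolding p_def r_def using J by (simp add: prod.subset_diff[of S J] S_def mult.commute)
  also have "\<dots> = lin i * p * q + smult (poly r (lam i)) p"
    by (subst r_eq) (simp add: algebra_simps)
  finally have "shift_act (\<Prod>j\<in>J. lin j) (\<lambda>t. resp t i) 0 =
      shift_act (lin i * p * q) (\<lambda>t. resp t i) 0 + poly r (lam i) * shift_act p (\<lambda>t. resp t i) 0"
    by (simp only: shift_act_add shift_act_smult)
  moreover have "shift_act (lin i * p * q) (\<lambda>t. resp t i) 0 = 0"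
  proof (rule shift_act_dvd_zero)
    show "(\<Prod>j\<in>insert i S. lin j) dvd lin i * p * q"
    proof -
      have "i \<notin> S"
        by (simp add: S_def)
      then show ?thesis
        using S by (simp add: p_def)
    qed
    show "shift_act (\<Prod>j\<in>insert i S. lin j) (\<lambda>t. resp t i) t = 0" for t
      using S i by (intro shift_act_resp_zero) (auto simp: S_def)
  qed
  moreover have "shift_act p (\<lambda>t. resp t i) 0 = 1"
  proof -
    have "lead_coeff p = 1"
      by (simp add: p_def lead_coeff_prod lin_def)
    moreover have "degree p = lev i - 1"
      using S by (simp add: p_def degree_prod_eq_sum_degree lin_def)
    ultimately show ?thesis
      using shift_act_resp_low_degree[OF i, of p] lev_pos[OF i] by simp
  qed
  ultimately show ?thesis
    using r by simp
qed

text \<open>Newton interpolation: the polynomial \<open>\<Prod>j\<in>J. lin j\<close> annihilates every response in the support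
  of \<open>w\<close> except that of a node maximal for the order that lists \<open>U\<close> first and then goes by level.\<close>

lemma resp_independent:
  assumes zero: "\<And>s t. \<lbrakk>s < m; t < n\<rbrakk> \<Longrightarrow>
      (\<Sum>i<n. w i * (if comp i = s then resp t i else 0)) = 0"
    and i: "i < n"
  shows "w i = 0"
proof (rule ccontr)
  assume wi: "w i \<noteq> 0"
  define K where "K = (\<Sum>s<m. height s)"
  have lev_K: "lev j \<le> K" if "j < n" for j
  proof -
    have "height (comp j) \<le> K"
      unfolding K_def using comp_less[OF that] by (intro member_le_sum) auto
    then show ?thesis
      using lev_le_height[OF that] by simp
  qed
  \<comment> \<open>\<open>K\<close> bounds all levels and levels are positive, so every state
    outside \<open>U\<close> comes after all of \<open>U\<close>.\<close>
  define key where "key j = (if j \<in> U then 0 else K) + lev j" for j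
  define W where "W = {j. j < n \<and> w j \<noteq> 0}"
  have "finite W" "W \<noteq> {}"
    using wi i by (auto simp: W_def)
  then have "Max (key ` W) \<in> key ` W"
    by (intro Max_in) auto
  then obtain v where "v \<in> W" "Max (key ` W) = key v"
    by blast
  then have v: "v \<in> W" "\<And>j. j \<in> W \<Longrightarrow> key j \<le> key v"
    using Max_ge[of "key ` W"] \<open>finite W\<close> by (simp, metis finite_imageI imageI)
  have vn: "v < n" and wv: "w v \<noteq> 0"
    using v(1) by (auto simp: W_def)
  define J where "J = {j. j < n \<and> j \<noteq> v \<and> comp j = comp v \<and> key j \<le> key v}"
  have J: "finite J"
    by (rule finite_subset[of _ "{..<n}"]) (auto simp: J_def)
  \<comment> \<open>Levels fall along a branch, and a branch that has entered \<open>U\<close> stays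
    in it.\<close>
  have key_anc: "key a < key j" if "j < n" "a \<in> ancs j" "a \<noteq> j" for a j
    using ancs_props[OF that(1,2)] that(3) lev_K[of a] lev_pos[of j] that(1)
    by (auto simp: key_def)
  let ?p = "\<Prod>j\<in>J. lin j"
  have "degree ?p = card J"
    by (simp add: degree_prod_eq_sum_degree lin_def)
  also have "\<dots> < n"
  proof -
    have "J \<subset> {..<n}"
      using vn by (auto simp: J_def)
    from psubset_card_mono[OF _ this] show ?thesis
      by simp
  qed
  finally have deg: "degree ?p < n" .
  \<comment> \<open>The whole branch of \<open>j\<close> has key at most that of \<open>v\<close>
    and avoids \<open>v\<close>, hence lies in \<open>J\<close>.\<close>
  have other: "w j * shift_act ?p (\<lambda>t. if comp j = comp v then resp t j else 0) 0 = 0"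
    if j: "j < n" "j \<noteq> v" for j
  proof (cases "w j = 0 \<or> comp j \<noteq> comp v")
    case False
    then have "key j \<le> key v"
      using v(2) j by (simp add: W_def)
    have "ancs j \<subseteq> J"
    proof
      fix a assume a: "a \<in> ancs j"
      have "key a \<le> key j"
        using key_anc[OF j(1) a] by (cases "a = j") auto
      moreover have "a \<noteq> v"
        using key_anc[OF j(1) a] \<open>key j \<le> key v\<close> j(2) by auto
      ultimately show "a \<in> J"
        using ancs_props[OF j(1) a] False \<open>key j \<le> key v\<close> by (simp add: J_def)
    qed
    then show ?thesis
      using shift_act_resp_zero[OF j(1) J] False by simp
  qed auto
  have "shift_act ?p (\<lambda>t. resp t v) 0 \<noteq> 0"
  proof (rule shift_act_resp_nonzero[OF vn J])
    show "ancs v - {v} \<subseteq> J"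
      using ancs_props[OF vn] key_anc[OF vn] by (fastforce simp: J_def)
    show "v \<notin> J"
      by (simp add: J_def)
    fix j assume j: "j \<in> J - ancs v"
    show "lam j \<noteq> lam v"
    \<comment> \<open>Off \<open>U\<close> the gain of \<open>v\<close> differs from all others. On
      \<open>U\<close>, every \<open>j\<close> in \<open>J\<close> lies on the same branch below
      \<open>v\<close>, so \<open>J - ancs v\<close> is empty.\<close>
    proof (cases "v \<in> U")
      case False
      then show ?thesis
        using j by (auto simp: lam_def J_def)
    next
      case True
      have jJ: "j < n" "comp j = comp v" "key j \<le> key v"
        using j by (auto simp: J_def)
      have "j \<in> U"
        using jJ True lev_K[OF vn] lev_pos[OF jJ(1)] by (auto simp: key_def split: if_splits)
      then have le: "lev j \<le> lev v"
        using jJ True by (simp add: key_def)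
      define d where "d = lev v - lev j"
      have d: "d < lev v"
        using lev_pos[OF jJ(1)] le by (simp add: d_def)
      note a = funpow_par[OF vn d]
      have "(par ^^ d) v = j"
      proof (rule U_inj)
        show "(par ^^ d) v \<in> U" "comp ((par ^^ d) v) = comp j"
          using a True jJ by auto
        show "lev ((par ^^ d) v) = lev j"
          using a le by (simp add: d_def)
      qed fact
      then have "j \<in> ancs v"
        using d by (auto simp: ancs_def)
      then show ?thesis
        using j by simp
    qed
  qed
  moreover have "w v * shift_act ?p (\<lambda>t. resp t v) 0 = 0"
  proof -
    \<comment> \<open>Only times up to \<open>degree ?p\<close> enter, and these are below
      \<open>n\<close>.\<close>
    have "0 = (\<Sum>t\<le>degree ?p. coeff ?p t *
        (\<Sum>j<n. w j * (if comp j = comp v then resp (0 + t) j else 0)))"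
      using zero[OF comp_less[OF vn]] deg by simp
    also have "\<dots> = shift_act ?p (\<lambda>t. \<Sum>j<n. w j * (if comp j = comp v then resp t j else 0)) 0"
      by (simp only: shift_act_def)
    also have "\<dots> = (\<Sum>j<n. w j * shift_act ?p (\<lambda>t. if comp j = comp v then resp t j else 0) 0)"
      by (rule shift_act_sum)
    also have "\<dots> = (\<Sum>j\<in>{v}. w j * shift_act ?p (\<lambda>t. if comp j = comp v then resp t j else 0) 0)"
      using vn other by (intro sum.mono_neutral_right) auto
    finally show ?thesis
      by simp
  qed
  ultimately show False
    using wv by simp
qed

section \<open>A controllable extended system with heterogeneous subsystems off
  \<open>U\<close>\<close>

lemma U_subset: "U \<subseteq> {..<n}"
  using U_less by auto

lemma achievable_off_spine:
  assumes "card U < n" "n_M \<ge> 2"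
  shows "achievable A B n_M (n - card U)"
proof -
  have dims: "dim_row A = n" "dim_col B = m"
    using A_carrier B_carrier by auto
  define k where "k i = (if i \<in> U then 1 else n_M)" for i
  have k_pos: "k i > 0" for i
    using assms(2) by (simp add: k_def)
  define N where "N = offset k n"
  let ?b = "block_of k"
  \<comment> \<open>The pattern leaves every permitted entry free.\<close>
  define Ah where "Ah = mat N N (\<lambda>(a, b). if ?b a = ?b b then if ?b a \<in> U then Fixed 0 else Free
    else if A $$ (?b a, ?b b) = Free then Free else Fixed 0)"
  define Bh where "Bh = mat N m (\<lambda>(a, s). if B $$ (?b a, s) = Free then Free else Fixed 0)"
  define Ch where "Ch = mat n N (\<lambda>(i, b). if i \<noteq> ?b b then Fixed 0
    else if k i = 1 then Fixed 1 else Free)"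
  define T where "T i j = (if i = j then lam i else if lev i > 1 \<and> j = par i then 1 else 0)" for i j
  \<comment> \<open>The realization uses only the first component of each block, where it is the
    forest with couplings \<open>T\<close>; the rest stays at zero.\<close>
  define A' where "A' = mat N N (\<lambda>(a, b). if a = offset k (?b a) \<and> b = offset k (?b b)
    then T (?b a) (?b b) else 0)"
  define B' where "B' = mat N m (\<lambda>(a, s). if a = offset k (?b a) \<and> lev (?b a) = 1 \<and> s = comp (?b a)
    then 1 else 0 :: real)"
  define C' where "C' = mat n N (\<lambda>(i, b). if b = offset k i then 1 else 0 :: real)"
  have idx: "offset k i + p < N" if "i < n" "p < k i" for i p
    unfolding N_def using that by (rule offset_less)
  have idx0: "offset k i < N" if "i < n" for i
    using idx[OF that k_pos] by simp
  have block0 [simp]: "?b (offset k i) = i" for i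
    using block_of_offset[of 0 k i] k_pos[of i] by simp
  have offset_eq: "offset k j + q = offset k i \<longleftrightarrow> i = j \<and> q = 0" if "q < k j" for i j q
    using block_of_offset[of q k j, OF that] block0[of i] by fastforce
  have ext: "extended_system A B k Ah Bh Ch"
    unfolding extended_system_def Let_def dims
  proof (intro conjI allI impI)
    show "k i \<ge> 1" for i
      using k_pos[of i] by simp
    show "Ah \<in> carrier_mat (offset k n) (offset k n)" "Bh \<in> carrier_mat (offset k n) m"
      "Ch \<in> carrier_mat n (offset k n)"
      by (simp_all add: Ah_def Bh_def Ch_def N_def)
    show "Ah $$ (offset k i + p, offset k j + q) = Fixed 0 \<or>
        Ah $$ (offset k i + p, offset k j + q) = Free \<and> A $$ (i, j) = Free"
      if "i < n" "j < n" "i \<noteq> j" "p < k i" "q < k j" for i j p q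
      using that idx by (simp add: Ah_def)
    show "Bh $$ (offset k i + p, s) = Fixed 0 \<or>
        Bh $$ (offset k i + p, s) = Free \<and> B $$ (i, s) = Free"
      if "i < n" "s < m" "p < k i" for i s p
      using that idx by (simp add: Bh_def)
    show "all_block_entries k Ah i Free \<or> all_block_entries k Ah i (Fixed 0)" if "i < n" for i
      using that idx by (simp add: all_block_entries_def Ah_def)
    show "Ch $$ (i, offset k j + q) =
        (if i \<noteq> j then Fixed 0 else if k j = 1 then Fixed 1 else Free)"
      if "i < n" "j < n" "q < k j" for i j q
      using that idx by (simp add: Ch_def)
  qed
  have real: "realization Ah A'" "realization Bh B'" "realization Ch C'"
  proof -
    have bn: "?b a < n" "offset k (?b a) \<le> a" if "a < N" for a
      using that unfolding N_def by (auto elim!: block_cases)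
    show "realization Ah A'"
      unfolding realization_def
    proof (intro conjI allI impI)
      show "A' \<in> carrier_mat (dim_row Ah) (dim_col Ah)"
        by (simp add: A'_def Ah_def)
      fix a b c assume "a < dim_row Ah" "b < dim_col Ah" and Fixed: "Ah $$ (a, b) = Fixed c"
      then have ab: "a < N" "b < N"
        by (auto simp: Ah_def)
      show "A' $$ (a, b) = c"
        using Fixed ab bn[OF ab(1)] par[of "?b a"]
        by (auto simp: Ah_def A'_def T_def lam_def split: if_splits)
    qed
    show "realization Bh B'"
      unfolding realization_def
    proof (intro conjI allI impI)
      show "B' \<in> carrier_mat (dim_row Bh) (dim_col Bh)"
        by (simp add: B'_def Bh_def)
      fix a s c assume "a < dim_row Bh" "s < dim_col Bh" and Fixed: "Bh $$ (a, s) = Fixed c"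
      then have as: "a < N" "s < m"
        by (auto simp: Bh_def)
      show "B' $$ (a, s) = c"
        using Fixed as lev_step[OF bn(1)[OF as(1)]]
        by (auto simp: Bh_def B'_def split: if_splits)
    qed
    show "realization Ch C'"
      unfolding realization_def
    proof (intro conjI allI impI)
      show "C' \<in> carrier_mat (dim_row Ch) (dim_col Ch)"
        by (simp add: C'_def Ch_def)
      fix i b c assume "i < dim_row Ch" "b < dim_col Ch" and Fixed: "Ch $$ (i, b) = Fixed c"
      then have ib: "i < n" "b < offset k n"
        by (auto simp: Ch_def N_def)
      from ib(2) obtain j q where "j < n" "q < k j" "b = offset k j + q"
        by (rule block_cases)
      then show "C' $$ (i, b) = c"
        using Fixed ib offset_eq[of q j i] by (auto simp: Ch_def C'_def N_def split: if_splits)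
    qed
  qed
  have A': "A' \<in> carrier_mat N N" and B': "B' \<in> carrier_mat N m" and C': "C' \<in> carrier_mat n N"
    by (simp_all add: A'_def B'_def C'_def)
  have markov: "(A' ^\<^sub>m t * B') $$ (offset k i, s) = (if comp i = s then resp t i else 0)"
    if "i < n" "s < m" for i s t
    using that
  proof (induction t arbitrary: i)
    case 0
    then show ?case
      using B' A' idx0[of i] by (auto simp: B'_def)
  next
    case (Suc t)
    let ?h = "\<lambda>j. (A' ^\<^sub>m t * B') $$ (offset k j, s)"
    have "(A' ^\<^sub>m Suc t * B') $$ (offset k i, s) =
        (\<Sum>b<N. A' $$ (offset k i, b) * (A' ^\<^sub>m t * B') $$ (b, s))"
      using A' B' idx0[OF Suc.prems(1)] Suc.prems(2) by (rule markov_Suc)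
    also have "\<dots> = (\<Sum>j<n. \<Sum>q<k j. A' $$ (offset k i, offset k j + q) *
        (A' ^\<^sub>m t * B') $$ (offset k j + q, s))"
      unfolding N_def sum_offset ..
    also have "\<dots> = (\<Sum>j<n. \<Sum>q<k j. if q = 0 then T i j * ?h j else 0)"
      using idx0[OF Suc.prems(1)] idx by (intro sum.cong refl) (auto simp: A'_def)
    also have "\<dots> = (\<Sum>j<n. T i j * ?h j)"
      using k_pos by simp
    also have "\<dots> = lam i * ?h i + (\<Sum>j\<in>{..<n} - {i}. T i j * ?h j)"
      using Suc.prems by (subst sum.remove[of _ i]) (auto simp: T_def)
    also have "(\<Sum>j\<in>{..<n} - {i}. T i j * ?h j) = (if lev i > 1 then ?h (par i) else 0)"
    proof (cases "lev i > 1")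
      case True
      have "par i \<in> {..<n} - {i}"
        using par[OF Suc.prems(1) True] by auto
      then have "(\<Sum>j\<in>{..<n} - {i}. T i j * ?h j) = (\<Sum>j\<in>{par i}. T i j * ?h j)"
        by (intro sum.mono_neutral_right) (auto simp: T_def)
      then show ?thesis
        using \<open>par i \<in> _\<close> True by (auto simp: T_def)
    qed (auto simp: T_def intro!: sum.neutral)
    finally show ?case
      using Suc par[of i] par_comp[of i] by auto
  qed
  have oc: "output_controllable A' B' C'"
    unfolding output_controllable_iff[OF A' B' C']
  proof (intro allI impI)
    fix w :: "nat \<Rightarrow> real" and i
    assume zero: "\<forall>s<m. \<forall>t<N. (\<Sum>i<n. w i * (\<Sum>b<N. C' $$ (i, b) * (A' ^\<^sub>m t * B') $$ (b, s))) = 0"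
      and i: "i < n"
    \<comment> \<open>Independence is tested at times below \<open>n\<close>, controllability at
      times below \<open>N\<close>.\<close>
    have "n \<le> N"
    proof -
      have "(\<Sum>j<n. 1) \<le> (\<Sum>j<n. k j)"
        using k_pos by (intro sum_mono) (simp add: Suc_le_eq)
      then show ?thesis
        by (simp add: N_def offset_def)
    qed
    have out: "(\<Sum>b<N. C' $$ (i, b) * (A' ^\<^sub>m t * B') $$ (b, s)) = (if comp i = s then resp t i else 0)"
      if "i < n" "s < m" for i s t
    proof -
      have "(\<Sum>b<N. C' $$ (i, b) * (A' ^\<^sub>m t * B') $$ (b, s)) =
          (\<Sum>b<N. if b = offset k i then (A' ^\<^sub>m t * B') $$ (b, s) else 0)"
        using that by (intro sum.cong) (auto simp: C'_def)
      then show ?thesis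
        using idx0[OF that(1)] markov[OF that] by simp
    qed
    show "w i = 0"
    proof (rule resp_independent[OF _ i])
      fix s t assume "s < m" "t < n"
      then have "(\<Sum>i<n. w i * (\<Sum>b<N. C' $$ (i, b) * (A' ^\<^sub>m t * B') $$ (b, s))) = 0"
        using zero \<open>n \<le> N\<close> by simp
      then show "(\<Sum>i<n. w i * (if comp i = s then resp t i else 0)) = 0"
        using out \<open>s < m\<close> by simp
    qed
  qed
  have types: "higher_order_heterogeneous k Ah i \<longleftrightarrow> i \<notin> U"
    "i \<in> U \<Longrightarrow> unmodified k Ah i" if "i < n" for i
    using that idx idx0 assms(2)
    by (auto simp: higher_order_heterogeneous_def unmodified_def all_block_entries_def Ah_def k_def)
  have "{i. i < n \<and> higher_order_heterogeneous k Ah i} = {..<n} - U"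
    using types(1) by auto
  then have card: "card {i. i < n \<and> higher_order_heterogeneous k Ah i} = n - card U"
    using U_subset by (simp add: card_Diff_subset finite_subset[OF U_subset])
  \<comment> \<open>Some subsystem lies off \<open>U\<close>, so the order \<open>n_M\<close> is
    attained.\<close>
  have "\<not> {..<n} \<subseteq> U"
    using card_mono[OF finite_subset[OF U_subset], of "{..<n}"] assms(1) by auto
  then have "Max (k ` {..<n}) = n_M"
    using assms(2) by (intro Max_eqI) (auto simp: k_def)
  then show ?thesis
    unfolding achievable_def structurally_output_controllable_def dims
    using ext real oc card types by blast
qed

end

text \<open>Existence of an achievable number is part of the conclusion because \<open>LEAST\<close>
  is meaningful only then. The lower bound is applied to a system attaining the minimum, whose
  orders are at most \<open>n_M\<close>.\<close>

theorem theorem3: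
  fixes n m n_M :: nat and A B :: "entry mat" and Z :: "node set"
  assumes "network n m A B"
    and "Y_network A B"
    and "max_stem_coverable A B Z"
    and "n_M \<ge> 2"
  shows "(\<exists>S. achievable A B n_M S) \<and>
    (real n - real (card Z)) / real n_M \<le> real (S_min A B n_M) \<and>
    real (S_min A B n_M) \<le> real n - real (card Z)"
proof -
  interpret Y_net n m A B
    using assms(1,2) by unfold_locales
  note card_Z = max_stem_coverable_card[OF assms(3)]
  obtain par U where "spine n m A B comp lev par U"
    by (rule spine_exists)
  then interpret spine n m A B comp lev par U .
  have card_U: "card U = card Z"
    using card_U card_Z(1) by simp
  then have upper: "achievable A B n_M (n - card Z)"
    using achievable_off_spine[OF _ assms(4)] card_Z(2) by simp
  then have "S_min A B n_M \<le> n - card Z"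
    unfolding S_min_def by (rule Least_le)
  then have le: "real (S_min A B n_M) \<le> real n - real (card Z)"
    using card_Z(2) by linarith
  have "achievable A B n_M (S_min A B n_M)"
    unfolding S_min_def using upper by (rule LeastI)
  then obtain k Ah Bh Ch where ext: "extended_system A B k Ah Bh Ch"
    "structurally_output_controllable Ah Bh Ch"
    and max: "Max (k ` {..<n}) = n_M"
    and card: "card {i. i < n \<and> higher_order_heterogeneous k Ah i} = S_min A B n_M"
    and types: "\<forall>i<n. higher_order_heterogeneous k Ah i \<or> unmodified k Ah i"
    unfolding achievable_def dims by blast
  have "k i \<le> n_M" if "i < n" for i
    unfolding max[symmetric] using that by (intro Max_ge) auto
  then have "n \<le> card Z + S_min A B n_M * n_M"
    using extended_order_bound[OF ext types, of n_M] card_Z(1) card by simp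
  then have "real n \<le> real (card Z) + real (S_min A B n_M) * real n_M"
    by (simp only: of_nat_add[symmetric] of_nat_mult[symmetric] of_nat_le_iff)
  then have "(real n - real (card Z)) / real n_M \<le> real (S_min A B n_M)"
    using assms(4) by (simp add: divide_le_eq)
  then show ?thesis
    using upper le by blast
qed

end
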